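(* Let $$t=\frac{\sqrt3}{2000},\qquad \epsilon=2\times10^{-21},\qquad |\psi\rangle=\frac{|0\rangle+t|3\rangle}{\sqrt{1+t^2}},\qquad \tau=\frac23\sum_{j=0}^\infty3^{-j}|j\rangle\langle j|,$$ and $\rho=(1-\epsilon)|\psi\rangle\langle\psi|+\epsilon\tau$. Then $$W_\rho(q,p)>\frac{79}{10000}\,W_0(q,p)>0\quad\text{for every }(q,p)\in\mathbb R^2,\qquad\text{and}\qquad h(W_\rho)-(1+\ln\pi)<0.$$
   Context: One bosonic mode on $L^2(\mathbb R)$ with $[\hat q,\hat p]=i$, $\hat a=(\hat q+i\hat p)/\sqrt2$; $|n\rangle$ are the Fock (number) states, $|n\rangle=(\hat a^\dagger)^n|0\rangle/\sqrt{n!}$ with $\hat a|0\rangle=0$. The Wigner function of a density operator is $W_\rho(q,p)=\frac1\pi\int_{\mathbb R}e^{2ipy}\langle q-y|\rho|q+y\rangle\,dy$, and $W_0(q,p)=\pi^{-1}e^{-q^2-p^2}$ is that of the vacuum. For $W_\rho\ge0$, $h(W_\rho)=-\int_{\mathbb R^2}W_\rho\ln W_\rho\,dq\,dp$ (natural logarithm); $h(W_0)=1+\ln\pi$. *)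

theory Defs
  imports "HOL-Probability.Probability"
begin

section \<open>One bosonic mode in the position representation\<close>

type_synonym wavefunction = "real \<Rightarrow> complex"

definition position_op :: "wavefunction \<Rightarrow> wavefunction" where
  "position_op f = (\<lambda>x. of_real x * f x)"

definition momentum_op :: "wavefunction \<Rightarrow> wavefunction" where
  "momentum_op f = (\<lambda>x. - \<i> * vector_derivative f (at x))"

definition annihilation_op :: "wavefunction \<Rightarrow> wavefunction" where
  "annihilation_op f = (\<lambda>x. (position_op f x + \<i> * momentum_op f x) / of_real (sqrt 2))"

definition creation_op :: "wavefunction \<Rightarrow> wavefunction" where
  "creation_op f = (\<lambda>x. (position_op f x - \<i> * momentum_op f x) / of_real (sqrt 2))"

text \<open>
  The vacuum is determined by \<open>annihilation_op vacuum = 0\<close> and normalisation, up to a phase,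
  on which neither density operators nor Wigner functions depend; see
  \<open>annihilation_vacuum\<close>, \<open>annihilation_unique\<close> and \<open>vacuum_normalised\<close> below.
\<close>

definition vacuum :: wavefunction where
  "vacuum = (\<lambda>x. of_real (pi powr (- 1 / 4) * exp (- x\<^sup>2 / 2)))"

definition fock :: "nat \<Rightarrow> wavefunction" where
  "fock n = (\<lambda>x. (creation_op ^^ n) vacuum x / of_real (sqrt (fact n)))"

section \<open>Operators, Wigner functions and entropy\<close>

text \<open>
  An operator \<open>A\<close> is represented by its position-space kernel \<open>A x x' = \<langle>x|A|x'\<rangle>\<close>, i.e.
  \<open>(A f)(x) = \<integral> A x x' f x' dx'\<close>.
\<close>

type_synonym kernel = "real \<Rightarrow> real \<Rightarrow> complex"

definition ketbra :: "wavefunction \<Rightarrow> wavefunction \<Rightarrow> kernel" where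
  "ketbra f g = (\<lambda>x x'. f x * cnj (g x'))"

text \<open>
  The integral below is real for the kernel of a self-adjoint operator (\<open>wigner_integral_real\<close>),
  so that taking the real part only adjusts the type.
\<close>

definition wigner :: "kernel \<Rightarrow> real \<Rightarrow> real \<Rightarrow> real" where
  "wigner A q p =
     1 / pi * Re (LINT y|lborel. exp (2 * \<i> * of_real p * of_real y) * A (q - y) (q + y))"

definition wigner_vacuum :: "real \<Rightarrow> real \<Rightarrow> real" where
  "wigner_vacuum q p = 1 / pi * exp (- q\<^sup>2 - p\<^sup>2)"

definition entropy_integrand :: "(real \<Rightarrow> real \<Rightarrow> real) \<Rightarrow> real \<times> real \<Rightarrow> real" where
  "entropy_integrand W = (\<lambda>(q, p). W q p * ln (W q p))"

text \<open>
  The Bochner integral of a non-integrable function is \<open>0\<close>; hence \<open>phase_space_entropy W\<close>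
  is meaningful only together with \<open>integrable lborel (entropy_integrand W)\<close>.
\<close>

definition phase_space_entropy :: "(real \<Rightarrow> real \<Rightarrow> real) \<Rightarrow> real" where
  "phase_space_entropy W = - (LINT z|lborel. entropy_integrand W z)"

section \<open>Consistency with the defining properties\<close>

lemma canonical_commutation:
  assumes "f differentiable (at x)"
  shows "position_op (momentum_op f) x - momentum_op (position_op f) x = \<i> * f x"
proof -
  have f: "(f has_vector_derivative vector_derivative f (at x)) (at x)"
    using assms by (simp add: vector_derivative_works)
  have "((\<lambda>x. of_real x * f x) has_vector_derivative
          of_real x * vector_derivative f (at x) + 1 * f x) (at x)"
    by (rule has_vector_derivative_mult[OF _ f])
       (rule has_vector_derivative_of_real[OF DERIV_ident, unfolded of_real_1])
  then have "vector_derivative (\<lambda>x. of_real x * f x) (at x) =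
               of_real x * vector_derivative f (at x) + f x"
    by (simp add: vector_derivative_at)
  then show ?thesis
    by (simp add: position_op_def momentum_op_def algebra_simps)
qed

lemma vacuum_has_vector_derivative:
  "(vacuum has_vector_derivative - of_real x * vacuum x) (at x)"
proof -
  have "((\<lambda>x. pi powr (- 1 / 4) * exp (- x\<^sup>2 / 2)) has_real_derivative
          - x * (pi powr (- 1 / 4) * exp (- x\<^sup>2 / 2))) (at x)"
    by (auto intro!: derivative_eq_intros)
  from has_vector_derivative_of_real[OF this] show ?thesis
    by (simp add: vacuum_def)
qed

lemma annihilation_vacuum: "annihilation_op vacuum = (\<lambda>x. 0)"
  using vector_derivative_at[OF vacuum_has_vector_derivative]
  by (simp add: annihilation_op_def position_op_def momentum_op_def fun_eq_iff flip: mult.assoc)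

lemma annihilation_unique:
  assumes "\<And>x. f differentiable (at x)" "annihilation_op f = (\<lambda>x. 0)"
  shows "\<exists>c. f = (\<lambda>x. c * vacuum x)"
proof -
  have df: "(f has_vector_derivative - of_real x * f x) (at x)" for x
  proof -
    have "position_op f x + \<i> * momentum_op f x = 0"
      using fun_cong[OF assms(2), of x] by (simp add: annihilation_op_def)
    then have "vector_derivative f (at x) = - of_real x * f x"
      by (simp add: position_op_def momentum_op_def add_eq_0_iff flip: mult.assoc)
    then show ?thesis
      using assms(1)[of x] by (simp add: vector_derivative_works)
  qed
  define g :: wavefunction where "g = (\<lambda>x. of_real (exp (x\<^sup>2 / 2)) * f x)"
  have "(g has_vector_derivative 0) (at x)" for x
  proof -
    have e: "((\<lambda>x. exp (x\<^sup>2 / 2)) has_real_derivative x * exp (x\<^sup>2 / 2)) (at x)"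
      by (auto intro!: derivative_eq_intros)
    have "(g has_vector_derivative
            of_real (exp (x\<^sup>2 / 2)) * (- of_real x * f x)
            + of_real (x * exp (x\<^sup>2 / 2)) * f x) (at x)"
      unfolding g_def
      by (rule has_vector_derivative_mult[OF has_vector_derivative_of_real[OF e] df])
    then show ?thesis by (simp add: algebra_simps)
  qed
  then obtain d where d: "\<And>x. g x = d"
    using has_vector_derivative_zero_constant[of UNIV g] by auto
  have "f x = d / of_real (pi powr (- 1 / 4)) * vacuum x" for x
  proof -
    have "exp (- x\<^sup>2 / 2) * exp (x\<^sup>2 / 2) = (1::real)"
      by (simp flip: exp_add)
    then have "f x = of_real (exp (- x\<^sup>2 / 2)) * g x"
      unfolding g_def by (simp only: flip: mult.assoc of_real_mult) simp
    then show ?thesis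
      unfolding d vacuum_def by simp
  qed
  then show ?thesis by blast
qed

lemma gaussian_fourier:
  "(LINT y|lborel. exp (2 * \<i> * of_real p * of_real y) * of_real (exp (- y\<^sup>2)))
     = complex_of_real (sqrt pi * exp (- p\<^sup>2))"
proof -
  have "complex_of_real (exp (- p\<^sup>2)) = char std_normal_distribution (sqrt 2 * p)"
    by (simp add: char_std_normal_distribution power_mult_distrib)
  also have "\<dots> = (LINT x|lborel. std_normal_density x *\<^sub>R iexp (sqrt 2 * p * x))"
    unfolding char_def by (subst integral_density) (auto simp: normal_density_nonneg)
  also have "\<dots> = sqrt 2 *\<^sub>R (LINT y|lborel.
                std_normal_density (sqrt 2 * y) *\<^sub>R iexp (sqrt 2 * p * (sqrt 2 * y)))"
    by (subst lborel_integral_real_affine[where c = "sqrt 2" and t = 0]) auto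
  also have "\<dots> = sqrt 2 *\<^sub>R (LINT y|lborel. (1 / sqrt (2 * pi)) *\<^sub>R
                (exp (2 * \<i> * of_real p * of_real y) * of_real (exp (- y\<^sup>2))))"
  proof -
    have "std_normal_density (sqrt 2 * y) *\<^sub>R iexp (sqrt 2 * p * (sqrt 2 * y)) =
          (1 / sqrt (2 * pi)) *\<^sub>R
            (exp (2 * \<i> * of_real p * of_real y) * of_real (exp (- y\<^sup>2)))" for y
    proof -
      have a: "sqrt 2 * p * (sqrt 2 * y) = 2 * p * y"
        by (simp add: mult.assoc mult.left_commute[of p] flip: mult.assoc)
      show ?thesis
        unfolding a std_normal_density_def
        by (simp add: power_mult_distrib scaleR_conv_of_real mult_ac)
    qed
    then show ?thesis by simp
  qed
  finally have "complex_of_real (exp (- p\<^sup>2)) = (1 / sqrt pi) *\<^sub>R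
      (LINT y|lborel. exp (2 * \<i> * of_real p * of_real y) * of_real (exp (- y\<^sup>2)))"
    by (simp add: real_sqrt_mult)
  then show ?thesis
    by (simp add: scaleR_conv_of_real field_simps)
qed

lemma cnj_vacuum: "cnj (vacuum x) = vacuum x"
  by (simp add: vacuum_def)

lemma vacuum_mult:
  "vacuum x * vacuum y = of_real (exp (- (x\<^sup>2 + y\<^sup>2) / 2) / sqrt pi)"
proof -
  have "pi powr (- 1 / 4) * pi powr (- 1 / 4) = 1 / sqrt pi"
    by (simp flip: powr_add add: powr_minus_divide powr_half_sqrt)
  then show ?thesis
    unfolding vacuum_def
    by (simp add: field_simps flip: exp_add of_real_mult)
qed

lemma vacuum_normalised: "(LINT x|lborel. (norm (vacuum x))\<^sup>2) = 1"
proof -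
  have "complex_of_real (LINT x|lborel. (norm (vacuum x))\<^sup>2) = (LINT x|lborel. vacuum x * vacuum x)"
    by (simp add: cnj_vacuum complex_norm_square del: of_real_power flip: integral_complex_of_real)
  also have "\<dots> = (LINT x|lborel. of_real (exp (- x\<^sup>2)) / of_real (sqrt pi))"
    by (simp add: vacuum_mult)
  also have "\<dots> = 1"
    using gaussian_fourier[of 0] by simp
  finally show ?thesis by (simp only: of_real_eq_1_iff)
qed

lemma wigner_vacuum_eq: "wigner (ketbra vacuum vacuum) q p = wigner_vacuum q p"
proof -
  have "exp (2 * \<i> * of_real p * of_real y) * ketbra vacuum vacuum (q - y) (q + y) =
      of_real (exp (- q\<^sup>2) / sqrt pi) *
        (exp (2 * \<i> * of_real p * of_real y) * of_real (exp (- y\<^sup>2)))" for y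
  proof -
    have a: "- ((q - y)\<^sup>2 + (q + y)\<^sup>2) / 2 = - q\<^sup>2 + - y\<^sup>2"
      by (simp add: power2_eq_square field_simps)
    show ?thesis
      unfolding ketbra_def cnj_vacuum vacuum_mult a exp_add by (simp add: mult_ac)
  qed
  then have "(LINT y|lborel. exp (2 * \<i> * of_real p * of_real y) *
        ketbra vacuum vacuum (q - y) (q + y)) =
      of_real (exp (- q\<^sup>2) / sqrt pi) * of_real (sqrt pi * exp (- p\<^sup>2))"
    by (simp only: integral_mult_right_zero gaussian_fourier)
  also have "\<dots> = of_real (exp (- q\<^sup>2 - p\<^sup>2))"
    by (simp add: exp_diff exp_minus field_simps flip: of_real_mult)
  finally show ?thesis
    by (simp add: wigner_def wigner_vacuum_def)
qed

lemma wigner_integral_real: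
  assumes "\<And>x x'. A x' x = cnj (A x x')"
  shows "Im (LINT y|lborel. exp (2 * \<i> * of_real p * of_real y) * A (q - y) (q + y)) = 0"
proof -
  let ?F = "\<lambda>y. exp (2 * \<i> * of_real p * of_real y) * A (q - y) (q + y)"
  have F: "cnj (?F y) = ?F (- y)" for y
    using assms[of "q + y" "q - y"] by (simp add: exp_cnj)
  have "cnj (LINT y|lborel. ?F y) = (LINT y|lborel. ?F (- y))"
    by (simp only: Bochner_Integration.integral_cnj[symmetric] F)
  also have "\<dots> = (LINT y|lborel. ?F y)"
    by (subst (2) lborel_integral_real_affine[where c = "-1" and t = 0]) auto
  finally show ?thesis
    by (simp add: complex_eq_iff)
qed

end

theory Submission
  imports Defs
begin

text \<open>
  Write \<open>s = q\<^sup>2 + p\<^sup>2\<close> and \<open>W\<^sub>\<rho> = W\<^sub>0 F\<close>. The superposition contributes to \<open>F\<close> the polynomial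
  \<open>1 + C / 500 - t\<^sup>2 L\<^sub>3(2 s)\<close> with \<open>C = Re (q + i p)\<^sup>3\<close>, up to normalisation. As \<open>\<bar>C\<bar> \<le> s\<^bsup>3/2\<^esup>\<close>, this is
  at least \<open>(1 - s\<^bsup>3/2\<^esup> / 1000)\<^sup>2\<close> up to lower order terms, which can be negative only near \<open>s = 100\<close>. The
  thermal state contributes \<open>\<epsilon> exp (s / 2) / 2\<close> by Mehler's formula, which exceeds \<open>5\<close> at \<open>s = 100\<close> although
  it is negligible in the bulk of the Gaussian.

  With \<open>E\<close> the expectation under \<open>W\<^sub>0\<close>, \<open>h(W\<^sub>\<rho>) - (1 + ln \<pi>) = E[F s] - 1 - E[F ln F]\<close>. To leading order
  the energy excess \<open>E[F s] - 1\<close> is \<open>6 t\<^sup>2 = 4.5 \<cdot> 10\<^bsup>-6\<^esup>\<close>, whereas \<open>E[F ln F]\<close> is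
  \<open>E[(C / 500)\<^sup>2] / 2 = 8 t\<^sup>2 = 6 \<cdot> 10\<^bsup>-6\<^esup>\<close>; the margin absorbs all error terms.
\<close>

section \<open>Hermite functions\<close>

text \<open>The recursion mirrors the action of \<open>creation_op\<close> on \<open>vacuum\<close>
  times a polynomial; it produces the physicists' Hermite polynomials.\<close>

primrec hermite :: "nat \<Rightarrow> real poly" where
  "hermite 0 = 1"
| "hermite (Suc n) = [:0, 2:] * hermite n - pderiv (hermite n)"

text \<open>Substituted into the defining recursion, this lowering relation removes the derivative
  and leaves the three-term recurrence that is matched with \<open>gauss_coeff_rec\<close>.\<close>

lemma pderiv_hermite_Suc: "pderiv (hermite (Suc n)) = smult (2 * real (Suc n)) (hermite n)"
proof (induction n)
  case 0
  show ?case by (simp add: pderiv_pCons pderiv_1)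
next
  case (Suc n)
  have *: "pderiv ([:0, 2:] :: real poly) = [:2:]"
    by (simp add: pderiv_pCons)
  have "pderiv (hermite (Suc (Suc n))) =
      smult 2 (hermite (Suc n)) + [:0, 2:] * pderiv (hermite (Suc n))
      - pderiv (pderiv (hermite (Suc n)))"
    unfolding hermite.simps(2)[of "Suc n"] pderiv_diff pderiv_mult * by simp
  also have "\<dots> = smult 2 (hermite (Suc n))
      + smult (2 * real (Suc n)) ([:0, 2:] * hermite n - pderiv (hermite n))"
    unfolding Suc pderiv_smult mult_smult_right smult_diff_right by simp
  also have "\<dots> = smult (2 + 2 * real (Suc n)) (hermite (Suc n))"
    unfolding hermite.simps(2)[symmetric] smult_add_left ..
  finally show ?case by (simp add: algebra_simps)
qed

lemma poly_hermite_Suc_Suc: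
  "poly (hermite (Suc (Suc n))) x =
     2 * x * poly (hermite (Suc n)) x - 2 * real (Suc n) * poly (hermite n) x"
  by (subst hermite.simps(2)) (simp del: hermite.simps(2) add: pderiv_hermite_Suc)

text \<open>Differentiating the Gaussian factor produces a second summand \<open>x * P\<close>, so x
  - d/dx acts on the polynomial factor as 2 x - d/dx.\<close>

lemma creation_vacuum_mult_poly:
  "creation_op (\<lambda>x. vacuum x * of_real (poly P x)) =
     (\<lambda>x. vacuum x * of_real (poly ([:0, 2:] * P - pderiv P) x / sqrt 2))"
proof
  fix x :: real
  have "((\<lambda>x. vacuum x * of_real (poly P x)) has_vector_derivative
      vacuum x * of_real (poly (pderiv P) x) + (- of_real x * vacuum x) * of_real (poly P x)) (at x)"
    by (intro has_vector_derivative_mult vacuum_has_vector_derivative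
        has_vector_derivative_of_real poly_DERIV)
  note D = vector_derivative_at[OF this]
  show "creation_op (\<lambda>x. vacuum x * of_real (poly P x)) x =
     vacuum x * of_real (poly ([:0, 2:] * P - pderiv P) x / sqrt 2)"
    unfolding creation_op_def position_op_def momentum_op_def D by (simp add: field_simps)
qed

lemma creation_op_scale:
  assumes "\<And>x. f differentiable (at x)"
  shows "creation_op (\<lambda>x. f x * of_real c) = (\<lambda>x. creation_op f x * of_real c)"
proof
  fix x :: real
  have "((\<lambda>x. f x * of_real c) has_vector_derivative vector_derivative f (at x) * of_real c) (at x)"
    using assms[of x] by (intro has_vector_derivative_mult_left) (simp add: vector_derivative_works)
  from vector_derivative_at[OF this]
  show "creation_op (\<lambda>x. f x * of_real c) x = creation_op f x * of_real c"
    by (simp add: creation_op_def position_op_def momentum_op_def algebra_simps diff_divide_distrib add_divide_distrib)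
qed

lemma differentiable_vacuum_mult_poly:
  "(\<lambda>x. vacuum x * of_real (poly P x)) differentiable (at x)"
proof -
  have "((\<lambda>x. vacuum x * of_real (poly P x)) has_vector_derivative
      vacuum x * of_real (poly (pderiv P) x) + (- of_real x * vacuum x) * of_real (poly P x)) (at x)"
    by (intro has_vector_derivative_mult vacuum_has_vector_derivative
        has_vector_derivative_of_real poly_DERIV)
  then show ?thesis
    by (rule differentiableI_vector)
qed

lemma creation_funpow_vacuum:
  "(creation_op ^^ n) vacuum = (\<lambda>x. vacuum x * of_real (poly (hermite n) x / sqrt (2 ^ n)))"
proof (induction n)
  case 0
  show ?case by simp
next
  case (Suc n)
  have "(creation_op ^^ Suc n) vacuum =
      creation_op (\<lambda>x. vacuum x * of_real (poly (hermite n) x) * of_real (1 / sqrt (2 ^ n)))"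
    by (simp add: Suc)
  also have "\<dots> = (\<lambda>x. vacuum x * of_real (poly (hermite (Suc n)) x / sqrt 2) * of_real (1 / sqrt (2 ^ n)))"
    by (subst creation_op_scale[OF differentiable_vacuum_mult_poly])
       (simp add: creation_vacuum_mult_poly)
  finally show ?case
    by (simp add: real_sqrt_mult)
qed

lemma fock_hermite:
  "fock n x = vacuum x * of_real (poly (hermite n) x / sqrt (2 ^ n * fact n))"
  by (simp add: fock_def creation_funpow_vacuum real_sqrt_mult)

section \<open>The generating function of the Hermite polynomials\<close>

text \<open>Taylor coefficients of exp (a z + b z^2), written as the Cauchy product of two
  exponential series. Real instances serve the recurrence and the norm bounds, complex ones the
  Gaussian integral in \<open>mehler\<close>.\<close>

definition gauss_coeff :: "'a::{real_normed_field,banach} \<Rightarrow> 'a \<Rightarrow> nat \<Rightarrow> 'a" where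
  "gauss_coeff a b n = (\<Sum>i\<le>n. a ^ i / fact i *
     (if even (n - i) then b ^ ((n - i) div 2) / fact ((n - i) div 2) else 0))"

lemma sums_exp_square:
  fixes b z :: "'a::{real_normed_field,banach}"
  defines "f \<equiv> \<lambda>n. (if even n then b ^ (n div 2) / fact (n div 2) else 0) * z ^ n"
  shows "f sums exp (b * z\<^sup>2)" and "summable (\<lambda>n. norm (f n))"
proof -
  have sm: "strict_mono (\<lambda>n::nat. 2 * n)"
    by (auto simp: strict_mono_def)
  have zero: "f n = 0" if "n \<notin> range (\<lambda>n. 2 * n)" for n
    using that by (auto simp: f_def elim!: evenE)
  have f2: "f (2 * n) = (b * z\<^sup>2) ^ n /\<^sub>R fact n" for n
    unfolding f_def power_mult[of z 2] power_mult_distrib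
    by (simp add: scaleR_conv_of_real divide_inverse)
  show "f sums exp (b * z\<^sup>2)"
    by (subst sums_mono_reindex[OF sm zero, symmetric]) (simp_all add: f2 exp_converges)
  show "summable (\<lambda>n. norm (f n))"
    by (subst summable_mono_reindex[OF sm, symmetric])
       (use zero summable_norm_exp[of "b * z\<^sup>2"] in \<open>simp_all add: f2\<close>)
qed

lemma gauss_coeff_sums:
  fixes a b z :: "'a::{real_normed_field,banach}"
  shows "(\<lambda>n. gauss_coeff a b n * z ^ n) sums exp (a * z + b * z\<^sup>2)"
proof -
  let ?f = "\<lambda>n. (a * z) ^ n /\<^sub>R fact n"
  let ?g = "\<lambda>n. (if even n then b ^ (n div 2) / fact (n div 2) else 0) * z ^ n"
  have "(\<lambda>k. \<Sum>i\<le>k. ?f i * ?g (k - i)) sums ((\<Sum>n. ?f n) * (\<Sum>n. ?g n))"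
    by (intro Cauchy_product_sums summable_norm_exp sums_exp_square)
  moreover have "(\<Sum>i\<le>k. ?f i * ?g (k - i)) = gauss_coeff a b k * z ^ k" for k
    unfolding gauss_coeff_def sum_distrib_right
  proof (intro sum.cong refl)
    fix i assume "i \<in> {..k}"
    then have "z ^ k = z ^ i * z ^ (k - i)"
      by (simp flip: power_add)
    then show "?f i * ?g (k - i) = a ^ i / fact i * (if even (k - i) then b ^ ((k - i) div 2) /
        fact ((k - i) div 2) else 0) * z ^ k"
      by (simp add: power_mult_distrib scaleR_conv_of_real field_simps)
  qed
  ultimately show ?thesis
    using sums_unique[OF exp_converges[of "a * z"]] sums_unique[OF sums_exp_square(1)[of b z]]
    by (simp add: exp_add)
qed

lemma norm_gauss_coeff_le: "norm (gauss_coeff a b n) \<le> gauss_coeff (norm a) (norm b) n"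
  unfolding gauss_coeff_def
  by (rule sum_norm_le) (auto simp: norm_mult norm_divide norm_power)

lemma gauss_coeff_nonneg: "0 \<le> a \<Longrightarrow> 0 \<le> b \<Longrightarrow> 0 \<le> gauss_coeff a b n" for a b :: real
  unfolding gauss_coeff_def by (rule sum_nonneg) auto

text \<open>Replacing all data by their norms makes every term nonnegative, hence a bound
  independent of \<open>N\<close>, as dominated convergence in \<open>mehler\<close>
  requires.\<close>

lemma norm_gauss_partial_sum_le:
  fixes a b z :: "'a::{real_normed_field,banach}"
  shows "norm (\<Sum>n<N. gauss_coeff a b n * z ^ n) \<le> exp (norm a * norm z + norm b * (norm z)\<^sup>2)"
proof -
  let ?m = "\<lambda>n. gauss_coeff (norm a) (norm b) n * norm z ^ n"
  have "norm (\<Sum>n<N. gauss_coeff a b n * z ^ n) \<le> (\<Sum>n<N. ?m n)"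
    by (rule sum_norm_le) (auto simp: norm_mult norm_power intro!: mult_right_mono norm_gauss_coeff_le)
  also have "\<dots> \<le> (\<Sum>n. ?m n)"
    using gauss_coeff_sums[of "norm a" "norm b" "norm z"]
    by (intro sum_le_suminf) (auto simp: sums_iff intro!: mult_nonneg_nonneg gauss_coeff_nonneg)
  also have "\<dots> = exp (norm a * norm z + norm b * (norm z)\<^sup>2)"
    using gauss_coeff_sums[of "norm a" "norm b" "norm z"] by (simp add: sums_iff)
  finally show ?thesis .
qed

text \<open>
  The generating function \<open>exp (a z + b z\<^sup>2)\<close> satisfies \<open>G' = (a + 2 b z) G\<close>,
  which is a three-term recurrence for its coefficients.
\<close>

lemma gauss_coeff_rec:
  fixes a b :: real
  shows "real (Suc (Suc n)) * gauss_coeff a b (Suc (Suc n)) =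
           a * gauss_coeff a b (Suc n) + 2 * b * gauss_coeff a b n"
proof -
  define B where "B = Abs_fps (\<lambda>n. if even n then b ^ (n div 2) / fact (n div 2) else 0)"
  define G where "G = fps_exp a * B"
  have G: "fps_nth G n = gauss_coeff a b n" for n
    by (simp add: G_def B_def gauss_coeff_def fps_mult_nth atMost_atLeast0)
  \<comment> \<open>\<open>B\<close> is the formal series of exp (b X^2), so this is B' = 2 b X B.
    At even \<open>n\<close> both coefficients vanish because \<open>B\<close> has only even
    powers.\<close>
  have dB: "fps_deriv B = fps_const (2 * b) * (fps_X * B)"
  proof (rule fps_ext)
    fix n
    show "fps_nth (fps_deriv B) n = fps_nth (fps_const (2 * b) * (fps_X * B)) n"
    proof (cases "even n")
      case True
      then show ?thesis by (cases n) (auto simp: B_def)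
    next
      case False
      then obtain k where "n = Suc (2 * k)" by (auto elim!: oddE)
      moreover have "fact k + fact k * real k \<noteq> 0"
        using fact_nonzero[of "Suc k", where 'a = real] by (simp add: algebra_simps)
      ultimately show ?thesis by (simp add: B_def field_simps)
    qed
  qed
  have dG: "fps_deriv G = fps_const a * G + fps_const (2 * b) * (fps_X * G)"
    by (simp add: G_def dB algebra_simps)
  have "fps_nth (fps_deriv G) (Suc n) = a * fps_nth G (Suc n) + 2 * b * fps_nth G n"
    unfolding dG by simp
  then show ?thesis
    by (simp add: G)
qed

text \<open>exp (2 x z - z^2) generates H_n / n!: both sides obey the same three-term recurrence and
  agree at n = 0 and n = 1.\<close>

lemma hermite_gauss_coeff: "poly (hermite n) x / fact n = gauss_coeff (2 * x) (- 1) n"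
proof (induction n rule: induct_nat_012)
  case 0
  show ?case by (simp add: gauss_coeff_def)
next
  case 1
  show ?case by (simp add: gauss_coeff_def pderiv_1)
next
  case (ge2 n)
  have "poly (hermite (Suc (Suc n))) x / fact (Suc (Suc n)) =
     (2 * x * (poly (hermite (Suc n)) x / fact (Suc n)) - 2 * (poly (hermite n) x / fact n)) / real (Suc (Suc n))"
    unfolding poly_hermite_Suc_Suc fact_Suc[of "Suc n"] fact_Suc[of n]
    by (simp del: of_nat_Suc add: divide_simps)
  also have "\<dots> = (real (Suc (Suc n)) * gauss_coeff (2 * x) (- 1) (Suc (Suc n))) / real (Suc (Suc n))"
    unfolding gauss_coeff_rec ge2 by simp
  finally show ?case by simp
qed

lemma of_real_gauss_coeff:
  "of_real (gauss_coeff a b n) = gauss_coeff (of_real a) (of_real b) n"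
  unfolding gauss_coeff_def by (auto simp: of_real_sum intro!: sum.cong)

section \<open>Gaussian integrals\<close>

lemma gaussian_moment_even:
  "has_bochner_integral lborel (\<lambda>x::real. exp (- x\<^sup>2) * x ^ (2 * k))
     (sqrt pi * (fact (2 * k) / (4 ^ k * fact k)))"
  using has_bochner_integral_even_function[OF gaussian_moment_even_pos[where k = k]]
  by (simp add: power_mult)

lemma gaussian_moment_odd:
  "has_bochner_integral lborel (\<lambda>x::real. exp (- x\<^sup>2) * x ^ (2 * k + 1)) 0"
  using gaussian_moment_odd_pos by (rule has_bochner_integral_odd_function) simp

text \<open>Moments of the probability density exp (- x^2) / sqrt pi, a centred normal law of
  variance 1/2.\<close>

definition gauss_moment :: "nat \<Rightarrow> real" where
  "gauss_moment n = (if even n then fact n / (4 ^ (n div 2) * fact (n div 2)) else 0)"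

lemma gaussian_moment:
  "has_bochner_integral lborel (\<lambda>x::real. exp (- x\<^sup>2) * x ^ n) (sqrt pi * gauss_moment n)"
proof (cases "even n")
  case True
  then obtain k where "n = 2 * k" by (rule evenE)
  then show ?thesis using gaussian_moment_even[of k] by (simp add: gauss_moment_def)
next
  case False
  then obtain k where "n = 2 * k + 1" by (rule oddE)
  then show ?thesis using gaussian_moment_odd[of k] by (simp add: gauss_moment_def)
qed

section \<open>Fourier transforms of Gaussians, also with polynomial factors\<close>

lemma gaussian_fourier_scaled:
  assumes "0 < l"
  shows "(LINT y|lborel. exp (2 * \<i> * of_real p * of_real y) * of_real (exp (- (l * y\<^sup>2))))
     = complex_of_real (sqrt (pi / l) * exp (- (p\<^sup>2 / l)))"
proof -
  have "(LINT y|lborel. exp (2 * \<i> * of_real (p / sqrt l) * of_real y) * of_real (exp (- y\<^sup>2))) =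
      sqrt l *\<^sub>R (LINT y|lborel. exp (2 * \<i> * of_real p * of_real y) * of_real (exp (- (l * y\<^sup>2))))"
    using assms
    by (subst lborel_integral_real_affine[where c = "sqrt l" and t = 0])
       (auto simp: power_mult_distrib field_simps intro!: Bochner_Integration.integral_cong)
  then have "sqrt l *\<^sub>R (LINT y|lborel. exp (2 * \<i> * of_real p * of_real y) * of_real (exp (- (l * y\<^sup>2)))) =
     complex_of_real (sqrt pi * exp (- (p\<^sup>2 / l)))"
    unfolding gaussian_fourier using assms by (simp add: power_divide)
  then show ?thesis
    using assms by (simp add: real_sqrt_divide scaleR_conv_of_real field_simps)
qed

lemma integrable_gaussian:
  assumes "0 < l"
  shows "integrable lborel (\<lambda>y::real. exp (- (l * y\<^sup>2)))"
proof -
  have "has_bochner_integral lborel (\<lambda>x::real. exp (- x\<^sup>2) * x ^ 0) (sqrt pi * gauss_moment 0)"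
    by (rule gaussian_moment)
  then have "integrable lborel (\<lambda>y::real. exp (- (0 + sqrt l * y)\<^sup>2))"
    using assms by (intro lborel_integrable_real_affine) (auto simp: has_bochner_integral_iff)
  then show ?thesis
    using assms by (simp add: power_mult_distrib)
qed

lemma has_bochner_gaussian_fourier:
  assumes "0 < l"
  shows "has_bochner_integral lborel
     (\<lambda>y. exp (2 * \<i> * of_real p * of_real y) * complex_of_real (exp (- (l * y\<^sup>2))))
     (of_real (sqrt (pi / l) * exp (- (p\<^sup>2 / l))))"
  unfolding has_bochner_integral_iff gaussian_fourier_scaled[OF assms, symmetric]
  by (intro conjI refl Bochner_Integration.integrable_bound[OF integrable_gaussian[OF assms]])
     (auto simp: norm_mult norm_exp_eq_Re)

definition gauss_fourier_moment :: "nat \<Rightarrow> real \<Rightarrow> complex" where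
  "gauss_fourier_moment k p =
     (LINT y|lborel. of_real (y ^ k) * (exp (2 * \<i> * of_real p * of_real y) * of_real (exp (- y\<^sup>2))))"

lemma integrable_gauss_fourier_moment:
  "integrable lborel
     (\<lambda>y. of_real (y ^ k) * (exp (2 * \<i> * of_real p * of_real y) * complex_of_real (exp (- y\<^sup>2))))"
proof (rule Bochner_Integration.integrable_bound)
  show "integrable lborel (\<lambda>x::real. exp (- x\<^sup>2) * x ^ k)"
    using gaussian_moment[of k] by (simp add: has_bochner_integral_iff)
qed (auto simp: norm_mult norm_exp_eq_Re abs_mult norm_power power_abs)

text \<open>The recurrence is \<open>0 = \<integral> (y ^ k exp (2 i p y - y\<^sup>2))' dy\<close>.\<close>

lemma gauss_fourier_moment_Suc:
  "2 * gauss_fourier_moment (Suc k) p =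
     2 * \<i> * p * gauss_fourier_moment k p + k * gauss_fourier_moment (k - 1) p"
proof -
  let ?E = "\<lambda>y::real. exp (2 * \<i> * of_real p * of_real y) * complex_of_real (exp (- y\<^sup>2))"
  let ?F = "\<lambda>y::real. of_real (y ^ k) * ?E y"
  let ?f = "\<lambda>y::real. of_nat k * (of_real (y ^ (k - 1)) * ?E y) + 2 * \<i> * p * (of_real (y ^ k) * ?E y)
      - 2 * (of_real (y ^ Suc k) * ?E y)"
  have int: "integrable lborel ?f"
    by (intro Bochner_Integration.integrable_add Bochner_Integration.integrable_diff integrable_mult_right)
      (rule integrable_gauss_fourier_moment)+
  have deriv: "(?F has_vector_derivative ?f y) (at y)" for y
  proof -
    have "((\<lambda>z. z ^ k * (exp (2 * \<i> * of_real p * z) * exp (- z\<^sup>2))) has_field_derivative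
        of_nat k * (of_real y ^ (k - 1) * (exp (2 * \<i> * of_real p * of_real y) * exp (- (of_real y)\<^sup>2)))
        + 2 * \<i> * p * (of_real y ^ k * (exp (2 * \<i> * of_real p * of_real y) * exp (- (of_real y)\<^sup>2)))
        - 2 * (of_real y ^ Suc k * (exp (2 * \<i> * of_real p * of_real y) * exp (- (of_real y)\<^sup>2))))
        (at (of_real y))"
      by (auto intro!: derivative_eq_intros simp: algebra_simps)
    note D = has_vector_derivative_real_field[OF this, where s = UNIV]
    have "complex_of_real (exp (- x\<^sup>2)) = exp (- (of_real x)\<^sup>2)" for x
      by (simp flip: exp_of_real)
    with D show ?thesis
      by (simp only: o_def of_real_power)
  qed
  have lim: "(?F \<longlongrightarrow> 0) at_top" "(?F \<longlongrightarrow> 0) at_bot"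
  proof -
    have "((\<lambda>y::real. \<bar>y\<bar> ^ k * exp (- y\<^sup>2)) \<longlongrightarrow> 0) at_top"
      by real_asymp
    then show "(?F \<longlongrightarrow> 0) at_top"
      by (rule tendsto_norm_zero_cancel[OF tendsto_cong[THEN iffD1, rotated]])
         (auto simp: norm_mult norm_exp_eq_Re norm_power)
    have "((\<lambda>y::real. \<bar>y\<bar> ^ k * exp (- y\<^sup>2)) \<longlongrightarrow> 0) at_bot"
      by real_asymp
    then show "(?F \<longlongrightarrow> 0) at_bot"
      by (rule tendsto_norm_zero_cancel[OF tendsto_cong[THEN iffD1, rotated]])
         (auto simp: norm_mult norm_exp_eq_Re norm_power)
  qed
  have cont: "isCont ?f y" for y
    by (intro continuous_intros)
  have "(LBINT y=-\<infinity>..\<infinity>. ?f y) = 0 - 0"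
  proof (rule interval_integral_FTC_integrable[where F = ?F])
    show "((?F \<circ> real_of_ereal) \<longlongrightarrow> 0) (at_right (- \<infinity>))"
      using lim(2) by (simp add: ereal_tendsto_simps)
    show "((?F \<circ> real_of_ereal) \<longlongrightarrow> 0) (at_left \<infinity>)"
      using lim(1) by (simp add: ereal_tendsto_simps)
    show "set_integrable lborel (einterval (- \<infinity>) \<infinity>) ?f"
      using int by (simp add: set_integrable_def)
  qed (use deriv cont in auto)
  then have "(LINT y|lborel. ?f y) = 0"
    by (simp add: interval_lebesgue_integral_def set_lebesgue_integral_def)
  also have "(LINT y|lborel. ?f y) = of_nat k * gauss_fourier_moment (k - 1) p
      + 2 * \<i> * p * gauss_fourier_moment k p - 2 * gauss_fourier_moment (Suc k) p"
    unfolding gauss_fourier_moment_def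
    apply (subst Bochner_Integration.integral_diff)
    apply (intro Bochner_Integration.integrable_add integrable_mult_right integrable_gauss_fourier_moment)
    apply (intro integrable_mult_right integrable_gauss_fourier_moment)
    apply (subst Bochner_Integration.integral_add)
    apply (intro integrable_mult_right integrable_gauss_fourier_moment)+
    apply (simp only: integral_mult_right_zero)
    done
  finally show ?thesis by (simp add: algebra_simps)
qed

lemma gauss_fourier_moment_0: "gauss_fourier_moment 0 p = of_real (sqrt pi * exp (- p\<^sup>2))"
  using gaussian_fourier[of p] by (simp add: gauss_fourier_moment_def)

text \<open>The kernel of the superposition at (q - y, q + y) is even in y, so only even moments
  occur later; the odd ones carry the recurrence.\<close>

lemma gauss_fourier_moment_values:
  "gauss_fourier_moment 1 p = \<i> * p * gauss_fourier_moment 0 p"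
  "gauss_fourier_moment 2 p = of_real (1 / 2 - p\<^sup>2) * gauss_fourier_moment 0 p"
  "gauss_fourier_moment 4 p = of_real (p ^ 4 - 3 * p\<^sup>2 + 3 / 4) * gauss_fourier_moment 0 p"
  "gauss_fourier_moment 6 p = of_real (15 / 8 - 45 / 4 * p\<^sup>2 + 15 / 2 * p ^ 4 - p ^ 6) * gauss_fourier_moment 0 p"
proof -
  let ?J = "\<lambda>k. gauss_fourier_moment k p"
  have J: "?J (Suc k) = \<i> * p * ?J k + k / 2 * ?J (k - 1)" for k
    using gauss_fourier_moment_Suc[of k p] by (simp add: field_simps)
  show 1: "?J 1 = \<i> * p * ?J 0"
    using J[of 0] by simp
  show 2: "?J 2 = of_real (1 / 2 - p\<^sup>2) * ?J 0"
    using J[of 1] 1 by (simp add: numeral_2_eq_2[symmetric] algebra_simps power2_eq_square)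
  have "?J 3 = \<i> * p * ?J 2 + ?J 1"
    using J[of 2] by simp
  then have 3: "?J 3 = \<i> * of_real (3 / 2 * p - p ^ 3) * ?J 0"
    unfolding 1 2 by (simp add: algebra_simps eval_nat_numeral)
  have "?J 4 = \<i> * p * ?J 3 + 3 / 2 * ?J 2"
    using J[of 3] by simp
  then show 4: "?J 4 = of_real (p ^ 4 - 3 * p\<^sup>2 + 3 / 4) * ?J 0"
    unfolding 2 3 by (simp add: algebra_simps eval_nat_numeral)
  have "?J 5 = \<i> * p * ?J 4 + 2 * ?J 3"
    using J[of 4] by simp
  then have 5: "?J 5 = \<i> * of_real (p ^ 5 - 5 * p ^ 3 + 15 / 4 * p) * ?J 0"
    unfolding 3 4 by (simp add: algebra_simps eval_nat_numeral)
  have "?J 6 = \<i> * p * ?J 5 + 5 / 2 * ?J 4"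
    using J[of 5] by simp
  then show 6: "?J 6 = of_real (15 / 8 - 45 / 4 * p\<^sup>2 + 15 / 2 * p ^ 4 - p ^ 6) * ?J 0"
    unfolding 4 5 by (simp add: algebra_simps eval_nat_numeral)
qed

section \<open>Mehler's formula and thermal states\<close>

text \<open>Coefficientwise form of E exp (2 i u z) = exp (- z^2) for u normal with variance
  1/2.\<close>

lemma gauss_moment_coeff:
  "(2 * \<i>) ^ m * complex_of_real (gauss_moment m) / fact m =
     (if even m then (- 1) ^ (m div 2) / fact (m div 2) else 0)"
proof (cases "even m")
  case True
  then obtain l where l: "m = 2 * l" by (rule evenE)
  have "(2 * \<i>) ^ (2 * l) = (- 1) ^ l * (4 :: complex) ^ l"
    by (simp add: power_mult power_mult_distrib flip: power_mult_distrib)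
  then show ?thesis
    using l by (simp add: gauss_moment_def)
qed (simp add: gauss_moment_def)

text \<open>Binomial expansion leaves moments of 2 i u, which by \<open>gauss_moment_coeff\<close>
  supply the factor exp (- z^2); the sum is then n! times the Taylor coefficient of exp (2 y z -
  z^2).\<close>

lemma hermite_gaussian_integral:
  "has_bochner_integral lborel
     (\<lambda>u. (2 * (of_real y + \<i> * of_real u)) ^ n * complex_of_real (exp (- u\<^sup>2)))
     (of_real (sqrt pi * poly (hermite n) y))"
proof -
  let ?c = "\<lambda>k. of_nat (n choose k) * (2 * complex_of_real y) ^ k * (2 * \<i>) ^ (n - k)"
  have "has_bochner_integral lborel
      (\<lambda>u. \<Sum>k\<le>n. ?c k * complex_of_real (exp (- u\<^sup>2) * u ^ (n - k)))
      (\<Sum>k\<le>n. ?c k * complex_of_real (sqrt pi * gauss_moment (n - k)))"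
    by (intro has_bochner_integral_sum has_bochner_integral_mult_right has_bochner_integral_of_real
        gaussian_moment)
  moreover have "(\<Sum>k\<le>n. ?c k * complex_of_real (exp (- u\<^sup>2) * u ^ (n - k))) =
      (2 * (of_real y + \<i> * of_real u)) ^ n * complex_of_real (exp (- u\<^sup>2))" for u
  proof -
    have "(2 * (of_real y + \<i> * of_real u)) ^ n = (2 * complex_of_real y + 2 * \<i> * of_real u) ^ n"
      by (simp add: algebra_simps)
    also have "\<dots> = (\<Sum>k\<le>n. ?c k * of_real (u ^ (n - k)))"
      unfolding binomial_ring by (simp add: power_mult_distrib mult_ac)
    finally have *: "(2 * (of_real y + \<i> * of_real u)) ^ n = (\<Sum>k\<le>n. ?c k * of_real (u ^ (n - k)))" .
    show ?thesis
      unfolding * sum_distrib_right by (simp add: mult_ac)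
  qed
  moreover have "(\<Sum>k\<le>n. ?c k * complex_of_real (sqrt pi * gauss_moment (n - k))) =
      of_real (sqrt pi * poly (hermite n) y)"
  proof -
    have "?c k * complex_of_real (sqrt pi * gauss_moment (n - k)) = of_real (sqrt pi * fact n) *
       ((2 * complex_of_real y) ^ k / fact k * (if even (n - k) then (- 1) ^ ((n - k) div 2) / fact ((n - k) div 2) else 0))"
      if "k \<le> n" for k
      using that unfolding gauss_moment_coeff[symmetric]
      by (simp add: binomial_fact field_simps)
    then have "(\<Sum>k\<le>n. ?c k * complex_of_real (sqrt pi * gauss_moment (n - k))) =
        of_real (sqrt pi * fact n) * gauss_coeff (2 * complex_of_real y) (- 1) n"
      unfolding gauss_coeff_def sum_distrib_left by (intro sum.cong refl) simp
    also have "gauss_coeff (2 * complex_of_real y) (- 1) n = of_real (poly (hermite n) y / fact n)"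
      unfolding hermite_gauss_coeff of_real_gauss_coeff by simp
    finally show ?thesis by simp
  qed
  ultimately show ?thesis by simp
qed

text \<open>Exponent of the integrable majorant in \<open>mehler\<close>. As w^2 < 1, the squared
  modulus uses up only part of the decay - u^2. Half of the gap 1 - w^2 pays for the cross term with
  \<open>x\<close>, the other half keeps a Gaussian in \<open>u\<close>.\<close>

lemma mehler_bound:
  fixes x y u w :: real
  assumes w: "\<bar>w\<bar> < 1"
  defines "\<kappa> \<equiv> (1 - w\<^sup>2) / 2"
  shows "2 * \<bar>x\<bar> * cmod (of_real w * (of_real y + \<i> * of_real u))
           + (cmod (of_real w * (of_real y + \<i> * of_real u)))\<^sup>2 - u\<^sup>2
         \<le> x\<^sup>2 / \<kappa> + (w\<^sup>2 + \<kappa>) * y\<^sup>2 - \<kappa> * u\<^sup>2"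
proof -
  define r where "r = cmod (of_real w * (of_real y + \<i> * of_real u))"
  have w2: "w\<^sup>2 < 1"
    using w by (simp add: abs_square_less_1)
  then have \<kappa>: "0 < \<kappa>" by (simp add: \<kappa>_def)
  have r2: "r\<^sup>2 = w\<^sup>2 * (y\<^sup>2 + u\<^sup>2)"
    by (simp add: r_def norm_mult power_mult_distrib cmod_power2)
  have "0 \<le> (\<bar>x\<bar> - \<kappa> * r)\<^sup>2 / \<kappa>"
    using \<kappa> by simp
  also have "\<dots> = x\<^sup>2 / \<kappa> + \<kappa> * r\<^sup>2 - 2 * \<bar>x\<bar> * r"
    using \<kappa> by (simp add: power2_diff power_mult_distrib field_simps power2_eq_square)
  finally have "2 * \<bar>x\<bar> * r + r\<^sup>2 \<le> x\<^sup>2 / \<kappa> + (w\<^sup>2 + \<kappa> * w\<^sup>2) * (y\<^sup>2 + u\<^sup>2)"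
    unfolding r2 by (simp add: algebra_simps)
  also have "\<dots> \<le> x\<^sup>2 / \<kappa> + (w\<^sup>2 + \<kappa> * 1) * (y\<^sup>2 + u\<^sup>2)"
    using w2 \<kappa> by (intro add_mono mult_right_mono mult_left_mono) auto
  also have "\<dots> = x\<^sup>2 / \<kappa> + (w\<^sup>2 + \<kappa>) * y\<^sup>2 + (1 - \<kappa>) * u\<^sup>2"
    by (simp add: \<kappa>_def field_simps)
  finally show ?thesis
    unfolding r_def by (simp add: algebra_simps)
qed

text \<open>
  Inserting \<open>\<surd>\<pi> H\<^sub>j(y) = \<integral> (2 (y + i u)) ^ j exp (- u\<^sup>2) du\<close> for one of the two Hermite polynomials turns
  the series into the generating function of the other one under a Gaussian integral.
\<close>

lemma mehler:
  fixes x y w :: real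
  assumes w: "\<bar>w\<bar> < 1"
  shows "(\<lambda>j. w ^ j / (2 ^ j * fact j) * poly (hermite j) x * poly (hermite j) y) sums
     (exp ((2 * w * x * y - w\<^sup>2 * (x\<^sup>2 + y\<^sup>2)) / (1 - w\<^sup>2)) / sqrt (1 - w\<^sup>2))"
proof -
  define \<kappa> where "\<kappa> = (1 - w\<^sup>2) / 2"
  have w2: "w\<^sup>2 < 1"
    using w by (simp add: abs_square_less_1)
  then have \<kappa>: "0 < \<kappa>" by (simp add: \<kappa>_def)
  let ?\<zeta> = "\<lambda>u. of_real w * (of_real y + \<i> * of_real u)"
  let ?G = "\<lambda>j. gauss_coeff (2 * complex_of_real x) (- 1) j"
  let ?s = "\<lambda>N u. (\<Sum>j<N. ?G j * ?\<zeta> u ^ j) * complex_of_real (exp (- u\<^sup>2))"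
  let ?f = "\<lambda>u. exp (2 * complex_of_real x * ?\<zeta> u + - 1 * (?\<zeta> u)\<^sup>2) * complex_of_real (exp (- u\<^sup>2))"
  let ?w = "\<lambda>u. exp (x\<^sup>2 / \<kappa> + (w\<^sup>2 + \<kappa>) * y\<^sup>2) * exp (- (\<kappa> * u\<^sup>2))"
  let ?a = "\<lambda>j. w ^ j / (2 ^ j * fact j) * poly (hermite j) x * poly (hermite j) y"
  \<comment> \<open>Integrated against the Gaussian, each partial sum of the generating function
    becomes sqrt pi times a partial sum of Mehler's series.\<close>
  have s: "has_bochner_integral lborel (?s N) (of_real (sqrt pi * (\<Sum>j<N. ?a j)))" for N
  proof -
    have "has_bochner_integral lborel
       (\<lambda>u. \<Sum>j<N. ?G j * of_real ((w / 2) ^ j) *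
          ((2 * (of_real y + \<i> * of_real u)) ^ j * complex_of_real (exp (- u\<^sup>2))))
       (\<Sum>j<N. ?G j * of_real ((w / 2) ^ j) * of_real (sqrt pi * poly (hermite j) y))"
      by (intro has_bochner_integral_sum has_bochner_integral_mult_right hermite_gaussian_integral)
    moreover have "?G j * of_real ((w / 2) ^ j) *
          ((2 * (of_real y + \<i> * of_real u)) ^ j * complex_of_real (exp (- u\<^sup>2))) =
        ?G j * ?\<zeta> u ^ j * complex_of_real (exp (- u\<^sup>2))" for j u
    proof -
      have "of_real ((w / 2) ^ j) * (2 * z) ^ j = (of_real w * z) ^ j" for z :: complex
        by (simp add: power_mult_distrib power_divide)
      then show ?thesis by (simp only: mult.assoc[symmetric]) (simp only: mult.assoc)
    qed
    moreover have "?G j * of_real ((w / 2) ^ j) * of_real (sqrt pi * poly (hermite j) y) =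
        of_real (sqrt pi * ?a j)" for j
    proof -
      have "?G j = of_real (poly (hermite j) x / fact j)"
        unfolding hermite_gauss_coeff of_real_gauss_coeff by simp
      then show ?thesis by (simp add: power_divide mult_ac)
    qed
    ultimately show ?thesis
      by (simp only: sum_distrib_right sum_distrib_left of_real_sum)
  qed
  have "(\<lambda>N. integral\<^sup>L lborel (?s N)) \<longlonglongrightarrow> integral\<^sup>L lborel ?f"
  proof (rule integral_dominated_convergence)
    show "integrable lborel ?w"
      by (intro integrable_mult_right integrable_gaussian \<kappa>)
    show "AE u in lborel. (\<lambda>N. ?s N u) \<longlonglongrightarrow> ?f u"
      using gauss_coeff_sums[of "2 * complex_of_real x" "- 1"]
      by (intro AE_I2 tendsto_mult_right) (simp only: sums_def)
    show "AE u in lborel. norm (?s N u) \<le> ?w u" for N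
    proof (rule AE_I2)
      fix u :: real
      have "norm (?s N u) \<le> exp (2 * \<bar>x\<bar> * cmod (?\<zeta> u) + (cmod (?\<zeta> u))\<^sup>2) * exp (- u\<^sup>2)"
        using norm_gauss_partial_sum_le[of "2 * complex_of_real x" "- 1" "?\<zeta> u" N]
        by (simp add: norm_mult)
      also have "\<dots> \<le> exp (x\<^sup>2 / \<kappa> + (w\<^sup>2 + \<kappa>) * y\<^sup>2 - \<kappa> * u\<^sup>2)"
        unfolding exp_add[symmetric] exp_le_cancel_iff
        using mehler_bound[OF w, of x y u] by (simp add: \<kappa>_def)
      also have "\<dots> = ?w u"
        by (simp add: exp_diff exp_minus divide_inverse)
      finally show "norm (?s N u) \<le> ?w u" .
    qed
  qed auto
  moreover have "integral\<^sup>L lborel ?f = of_real (sqrt pi *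
      (exp ((2 * w * x * y - w\<^sup>2 * (x\<^sup>2 + y\<^sup>2)) / (1 - w\<^sup>2)) / sqrt (1 - w\<^sup>2)))"
  proof -
    \<comment> \<open>Collecting the exponent by powers of \<open>u\<close> gives the linear term 2
      i p u and the quadratic term - (1 - w^2) u^2, so the limit is a Gaussian Fourier integral at
      \<open>p\<close>.\<close>
    define p where "p = w * x - w\<^sup>2 * y"
    have "?f u = of_real (exp (2 * w * x * y - w\<^sup>2 * y\<^sup>2)) *
       (exp (2 * \<i> * of_real p * of_real u) * complex_of_real (exp (- ((1 - w\<^sup>2) * u\<^sup>2))))" for u
    proof -
      have "2 * complex_of_real x * ?\<zeta> u + - 1 * (?\<zeta> u)\<^sup>2 + of_real (- u\<^sup>2) =
          of_real (2 * w * x * y - w\<^sup>2 * y\<^sup>2) + 2 * \<i> * of_real p * of_real u + of_real (- ((1 - w\<^sup>2) * u\<^sup>2))"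
        by (simp add: p_def power2_eq_square algebra_simps)
      then show ?thesis
        unfolding exp_of_real[symmetric] exp_add[symmetric] by (simp only: add.assoc)
    qed
    then have "integral\<^sup>L lborel ?f =
        of_real (exp (2 * w * x * y - w\<^sup>2 * y\<^sup>2)) * of_real (sqrt (pi / (1 - w\<^sup>2)) * exp (- (p\<^sup>2 / (1 - w\<^sup>2))))"
      using w2 by (simp only: integral_mult_right_zero) (simp add: gaussian_fourier_scaled)
    also have "\<dots> = of_real (sqrt pi *
        (exp (2 * w * x * y - w\<^sup>2 * y\<^sup>2 - p\<^sup>2 / (1 - w\<^sup>2)) / sqrt (1 - w\<^sup>2)))"
      by (simp add: exp_diff exp_minus exp_add real_sqrt_divide field_simps)
    also have "2 * w * x * y - w\<^sup>2 * y\<^sup>2 - p\<^sup>2 / (1 - w\<^sup>2) =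
        (2 * w * x * y - w\<^sup>2 * (x\<^sup>2 + y\<^sup>2)) / (1 - w\<^sup>2)"
      using w2 by (simp add: p_def divide_simps) (simp add: algebra_simps power2_eq_square)
    finally show ?thesis .
  qed
  ultimately have "(\<lambda>N. complex_of_real (sqrt pi * (\<Sum>j<N. ?a j))) \<longlonglongrightarrow> of_real (sqrt pi *
      (exp ((2 * w * x * y - w\<^sup>2 * (x\<^sup>2 + y\<^sup>2)) / (1 - w\<^sup>2)) / sqrt (1 - w\<^sup>2)))"
    by (simp only: has_bochner_integral_integral_eq[OF s])
  from tendsto_Re[OF this] have "(\<lambda>N. sqrt pi * (\<Sum>j<N. ?a j)) \<longlonglongrightarrow> sqrt pi *
      (exp ((2 * w * x * y - w\<^sup>2 * (x\<^sup>2 + y\<^sup>2)) / (1 - w\<^sup>2)) / sqrt (1 - w\<^sup>2))"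
    by (simp only: Re_complex_of_real)
  from tendsto_mult[OF tendsto_const[of "1 / sqrt pi"] this]
  show ?thesis
    by (simp add: sums_def)
qed

text \<open>Mehler's formula times two vacuum factors; the squared Fock normalisation supplies the
  weight 1 / (2^j j!). It also shows that the infinite sum in the thermal kernel is a genuine
  limit.\<close>

lemma thermal_kernel_sums:
  fixes w x x' :: real
  assumes w: "\<bar>w\<bar> < 1"
  shows "(\<lambda>j. of_real (w ^ j) * ketbra (fock j) (fock j) x x') sums
     of_real (exp (- (x\<^sup>2 + x'\<^sup>2) / 2 + (2 * w * x * x' - w\<^sup>2 * (x\<^sup>2 + x'\<^sup>2)) / (1 - w\<^sup>2)) /
       (sqrt pi * sqrt (1 - w\<^sup>2)))"
proof -
  have "of_real (w ^ j) * ketbra (fock j) (fock j) x x' =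
      of_real (exp (- (x\<^sup>2 + x'\<^sup>2) / 2) / sqrt pi *
        (w ^ j / (2 ^ j * fact j) * poly (hermite j) x * poly (hermite j) x'))" for j
  proof -
    define r where "r = sqrt (2 ^ j * fact j)"
    have *: "r * r = 2 ^ j * fact j"
      by (simp add: r_def)
    have "of_real (w ^ j) * ketbra (fock j) (fock j) x x' = of_real (w ^ j *
        (poly (hermite j) x * poly (hermite j) x' / (r * r))) * (vacuum x * vacuum x')"
      by (simp add: ketbra_def fock_hermite cnj_vacuum flip: r_def)
    then show ?thesis
      unfolding * vacuum_mult by (simp add: field_simps)
  qed
  then show ?thesis
    using sums_mult[OF mehler[OF w, of x x'], of "exp (- (x\<^sup>2 + x'\<^sup>2) / 2) / sqrt pi"]
    by (simp only: sums_of_real_iff exp_add) simp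
qed

text \<open>In the coordinates q - y, q + y the exponent separates into - q^2 / l - l y^2, and the
  Fourier transform turns the second part into - p^2 / l, so the result is radial.\<close>

lemma wigner_integrand_thermal:
  fixes w q p :: real
  assumes w: "\<bar>w\<bar> < 1"
  shows "has_bochner_integral lborel
     (\<lambda>y. exp (2 * \<i> * of_real p * of_real y) *
        (\<Sum>j. of_real (w ^ j) * ketbra (fock j) (fock j) (q - y) (q + y)))
     (of_real (exp (- ((1 - w) / (1 + w) * (q\<^sup>2 + p\<^sup>2))) / (1 + w)))"
proof -
  define l where "l = (1 + w) / (1 - w)"
  have pos: "0 < 1 + w" "0 < 1 - w" "0 < l"
    using w by (auto simp: l_def)
  have w2: "1 - w\<^sup>2 = (1 + w) * (1 - w)"
    by (simp add: power2_eq_square algebra_simps)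
  let ?c = "exp (- (q\<^sup>2 / l)) / (sqrt pi * sqrt (1 - w\<^sup>2))"
  have "- ((q - y)\<^sup>2 + (q + y)\<^sup>2) / 2
      + (2 * w * (q - y) * (q + y) - w\<^sup>2 * ((q - y)\<^sup>2 + (q + y)\<^sup>2)) / (1 - w\<^sup>2) =
      - (q\<^sup>2 / l) + - (l * y\<^sup>2)" for y
    unfolding w2 l_def using pos
    by (simp add: divide_simps) (simp add: algebra_simps power2_eq_square)
  then have "(\<Sum>j. of_real (w ^ j) * ketbra (fock j) (fock j) (q - y) (q + y)) =
      of_real ?c * complex_of_real (exp (- (l * y\<^sup>2)))" for y
    using sums_unique[OF thermal_kernel_sums[OF w, of "q - y" "q + y"]]
    by (simp only: exp_add) simp
  then have "has_bochner_integral lborel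
     (\<lambda>y. exp (2 * \<i> * of_real p * of_real y) *
        (\<Sum>j. of_real (w ^ j) * ketbra (fock j) (fock j) (q - y) (q + y)))
     (of_real ?c * of_real (sqrt (pi / l) * exp (- (p\<^sup>2 / l))))"
    using has_bochner_integral_mult_right[OF has_bochner_gaussian_fourier[OF pos(3), of p], of "of_real ?c"]
    by (simp only: mult_ac)
  moreover have "?c * (sqrt (pi / l) * exp (- (p\<^sup>2 / l))) =
      exp (- ((1 - w) / (1 + w) * (q\<^sup>2 + p\<^sup>2))) / (1 + w)"
  proof -
    have "sqrt (pi / l) = sqrt pi * sqrt (1 - w) / sqrt (1 + w)"
      using pos by (simp add: l_def real_sqrt_divide real_sqrt_mult)
    moreover have "sqrt (1 - w\<^sup>2) = sqrt (1 + w) * sqrt (1 - w)"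
      by (simp add: w2 real_sqrt_mult)
    moreover have "sqrt (1 + w) * sqrt (1 + w) = 1 + w"
      using pos by simp
    moreover have "exp (- ((1 - w) / (1 + w) * (q\<^sup>2 + p\<^sup>2))) = exp (- (q\<^sup>2 / l)) * exp (- (p\<^sup>2 / l))"
    proof -
      have "(1 - w) / (1 + w) = 1 / l"
        by (simp add: l_def)
      then show ?thesis
        unfolding exp_add[symmetric] by (simp add: add_divide_distrib)
    qed
    moreover have "X / (P * (a * b)) * (P * b / a * Y) = X * Y / (a * a)"
      if "P \<noteq> 0" "b \<noteq> 0" for X Y P a b :: real
      using that by simp
    ultimately show ?thesis
      using pos by (simp only: pi_neq_zero real_sqrt_eq_zero_cancel_iff) simp
  qed
  ultimately show ?thesis
    by (simp only: of_real_mult[symmetric])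
qed

section \<open>The Wigner function of the perturbed vacuum\<close>

text \<open>\<open>- L\<^sub>3(2 s)\<close> with the Laguerre polynomial \<open>L\<^sub>3\<close>.\<close>

definition fock3_ratio :: "real \<Rightarrow> real" where
  "fock3_ratio s = - 1 + 6 * s - 6 * s\<^sup>2 + 4 / 3 * s ^ 3"

text \<open>Real part of (q + i p)^3, which arises from the cross terms of |0> and |3>. Its angular
  dependence makes it orthogonal to radial functions, so normalisation and energy have no term of
  first order in t.\<close>

definition cubic_harmonic :: "real \<Rightarrow> real \<Rightarrow> real" where
  "cubic_harmonic q p = q ^ 3 - 3 * q * p\<^sup>2"

lemma poly_hermite_3: "poly (hermite 3) x = 8 * x ^ 3 - 12 * x"
  by (simp add: eval_nat_numeral pderiv_pCons pderiv_diff pderiv_mult pderiv_1 algebra_simps)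

text \<open>The factor sqrt 3 in \<open>t\<close> cancels against the normalisation sqrt 48 = 4 sqrt
  3 of \<open>fock 3\<close>, which makes the polynomial factor rational.\<close>

lemma superposition_eq:
  fixes t :: real
  assumes t: "t = sqrt 3 / 2000"
  shows "(fock 0 x + of_real t * fock 3 x) / of_real (sqrt (1 + t\<^sup>2)) =
    vacuum x * of_real ((1 + (2 * x ^ 3 - 3 * x) / 2000) / sqrt (1 + t\<^sup>2))"
proof -
  have "sqrt (2 ^ 3 * fact 3) = 4 * sqrt 3"
    by (rule real_sqrt_unique) (simp_all add: power_mult_distrib fact_numeral)
  then have "t * (poly (hermite 3) x / sqrt (2 ^ 3 * fact 3)) = (2 * x ^ 3 - 3 * x) / 2000"
    by (simp add: t poly_hermite_3 field_simps)
  moreover have "(fock 0 x + of_real t * fock 3 x) / of_real (sqrt (1 + t\<^sup>2)) =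
     vacuum x * of_real ((1 + t * (poly (hermite 3) x / sqrt (2 ^ 3 * fact 3))) / sqrt (1 + t\<^sup>2))"
    unfolding fock_hermite by (simp add: algebra_simps add_divide_distrib)
  ultimately show ?thesis by (simp only:)
qed

lemma wigner_integrand_superposition:
  fixes t :: real
  assumes t: "t = sqrt 3 / 2000"
    and \<psi>: "\<psi> = (\<lambda>x. (fock 0 x + of_real t * fock 3 x) / of_real (sqrt (1 + t\<^sup>2)))"
  shows "has_bochner_integral lborel
     (\<lambda>y. exp (2 * \<i> * of_real p * of_real y) * ketbra \<psi> \<psi> (q - y) (q + y))
     (of_real (exp (- q\<^sup>2 - p\<^sup>2) *
        (1 + cubic_harmonic q p / 500 + t\<^sup>2 * fock3_ratio (q\<^sup>2 + p\<^sup>2)) / (1 + t\<^sup>2)))"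
proof -
  \<comment> \<open>\<open>A0\<close> to \<open>A6\<close> are the coefficients of the powers of
    \<open>y\<close> in the product of the polynomial factors at q - y and q + y.\<close>
  define A0 where "A0 = 1 + (4 * q ^ 3 - 6 * q) / 2000 + (4 * q ^ 6 - 12 * q ^ 4 + 9 * q\<^sup>2) / 4000000"
  define A2 where "A2 = 12 * q / 2000 - (12 * q ^ 4 + 9) / 4000000"
  define A4 where "A4 = (12 * q\<^sup>2 + 12) / 4000000"
  define A6 where "A6 = - 4 / (4000000 :: real)"
  define c where "c = exp (- q\<^sup>2) / (sqrt pi * (1 + t\<^sup>2))"
  let ?E = "\<lambda>y. exp (2 * \<i> * of_real p * of_real y) * complex_of_real (exp (- y\<^sup>2))"
  have t1: "0 < 1 + t\<^sup>2"
    by (simp add: add_pos_nonneg)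
  have ket: "exp (2 * \<i> * of_real p * of_real y) * ketbra \<psi> \<psi> (q - y) (q + y) =
     of_real (c * A0) * (of_real (y ^ 0) * ?E y) + of_real (c * A2) * (of_real (y ^ 2) * ?E y)
     + of_real (c * A4) * (of_real (y ^ 4) * ?E y) + of_real (c * A6) * (of_real (y ^ 6) * ?E y)" for y
  proof -
    have e: "exp (- ((q - y)\<^sup>2 + (q + y)\<^sup>2) / 2) = exp (- q\<^sup>2) * exp (- y\<^sup>2)"
      unfolding exp_add[symmetric] by (simp add: power2_eq_square field_simps)
    have Q: "(1 + (2 * (q - y) ^ 3 - 3 * (q - y)) / 2000) * (1 + (2 * (q + y) ^ 3 - 3 * (q + y)) / 2000) =
       A0 + A2 * y\<^sup>2 + A4 * y ^ 4 + A6 * y ^ 6"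
      unfolding A0_def A2_def A4_def A6_def by (simp add: field_simps eval_nat_numeral)
    have "ketbra \<psi> \<psi> (q - y) (q + y) = vacuum (q - y) * vacuum (q + y) *
       of_real ((1 + (2 * (q - y) ^ 3 - 3 * (q - y)) / 2000) * (1 + (2 * (q + y) ^ 3 - 3 * (q + y)) / 2000)
         / (sqrt (1 + t\<^sup>2) * sqrt (1 + t\<^sup>2)))"
      unfolding ketbra_def \<psi> superposition_eq[OF t] complex_cnj_mult complex_cnj_complex_of_real cnj_vacuum
        times_divide_times_eq[symmetric] of_real_mult
      by (simp only: mult_ac)
    also have "sqrt (1 + t\<^sup>2) * sqrt (1 + t\<^sup>2) = 1 + t\<^sup>2"
      using t1 by simp
    also have "vacuum (q - y) * vacuum (q + y) * of_real ((1 + (2 * (q - y) ^ 3 - 3 * (q - y)) / 2000) *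
         (1 + (2 * (q + y) ^ 3 - 3 * (q + y)) / 2000) / (1 + t\<^sup>2)) =
       of_real (c * (A0 + A2 * y\<^sup>2 + A4 * y ^ 4 + A6 * y ^ 6) * exp (- y\<^sup>2))"
      unfolding vacuum_mult Q e c_def of_real_mult[symmetric]
      by (rule arg_cong[where f = of_real]) (simp add: mult_ac)
    finally show ?thesis
      by (simp add: algebra_simps)
  qed
  have "has_bochner_integral lborel
     (\<lambda>y. exp (2 * \<i> * of_real p * of_real y) * ketbra \<psi> \<psi> (q - y) (q + y))
     (of_real (c * A0) * gauss_fourier_moment 0 p + of_real (c * A2) * gauss_fourier_moment 2 p
      + of_real (c * A4) * gauss_fourier_moment 4 p + of_real (c * A6) * gauss_fourier_moment 6 p)"
    unfolding ket
    by (intro has_bochner_integral_add has_bochner_integral_mult_right)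
       (simp_all only: has_bochner_integral_iff gauss_fourier_moment_def integrable_gauss_fourier_moment)
  also have "of_real (c * A0) * gauss_fourier_moment 0 p + of_real (c * A2) * gauss_fourier_moment 2 p
      + of_real (c * A4) * gauss_fourier_moment 4 p + of_real (c * A6) * gauss_fourier_moment 6 p =
    complex_of_real (c * (sqrt pi * exp (- p\<^sup>2)) * (A0 + A2 * (1 / 2 - p\<^sup>2)
      + A4 * (p ^ 4 - 3 * p\<^sup>2 + 3 / 4) + A6 * (15 / 8 - 45 / 4 * p\<^sup>2 + 15 / 2 * p ^ 4 - p ^ 6)))"
    unfolding gauss_fourier_moment_values gauss_fourier_moment_0 of_real_mult[symmetric] of_real_add[symmetric]
    by (simp only: algebra_simps)
  also have "A0 + A2 * (1 / 2 - p\<^sup>2)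
      + A4 * (p ^ 4 - 3 * p\<^sup>2 + 3 / 4) + A6 * (15 / 8 - 45 / 4 * p\<^sup>2 + 15 / 2 * p ^ 4 - p ^ 6) =
     1 + cubic_harmonic q p / 500 + t\<^sup>2 * fock3_ratio (q\<^sup>2 + p\<^sup>2)"
    unfolding A0_def A2_def A4_def A6_def cubic_harmonic_def fock3_ratio_def t
    by (simp add: power_divide) (simp add: field_simps eval_nat_numeral)
  also have "c * (sqrt pi * exp (- p\<^sup>2)) = exp (- q\<^sup>2 - p\<^sup>2) / (1 + t\<^sup>2)"
  proof -
    have "exp (- q\<^sup>2 - p\<^sup>2) = exp (- q\<^sup>2) * exp (- p\<^sup>2)"
      by (simp flip: exp_add)
    then show ?thesis
      unfolding c_def by simp
  qed
  finally show ?thesis by simp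
qed

text \<open>Quotient of the Wigner functions of the mixture and the vacuum: 3 / 4000000 is t^2, and
  1 / 10^21 is \<epsilon> / 2, from \<epsilon> * (2 / 3) / (1 + 1 / 3). The thermal exp (- s / 2)
  divided by exp (- s) becomes exp (s / 2).\<close>

definition vacuum_ratio :: "real \<Rightarrow> real \<Rightarrow> real" where
  "vacuum_ratio q p = (1 - 2 / 10 ^ 21) / (1 + 3 / 4000000) *
     (1 + cubic_harmonic q p / 500 + 3 / 4000000 * fock3_ratio (q\<^sup>2 + p\<^sup>2))
     + 1 / 10 ^ 21 * exp ((q\<^sup>2 + p\<^sup>2) / 2)"

lemma wigner_mixture:
  fixes t \<epsilon> :: real and \<psi> :: wavefunction and \<tau> \<rho> :: kernel
  assumes t: "t = sqrt 3 / 2000"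
    and \<epsilon>: "\<epsilon> = 2 / 10 ^ 21"
    and \<psi>: "\<psi> = (\<lambda>x. (fock 0 x + of_real t * fock 3 x) / of_real (sqrt (1 + t\<^sup>2)))"
    and \<tau>: "\<tau> = (\<lambda>x x'. 2 / 3 * (\<Sum>j. (1 / 3 ^ j) * ketbra (fock j) (fock j) x x'))"
    and \<rho>: "\<rho> = (\<lambda>x x'. of_real (1 - \<epsilon>) * ketbra \<psi> \<psi> x x' + of_real \<epsilon> * \<tau> x x')"
  shows "wigner \<rho> q p = wigner_vacuum q p * vacuum_ratio q p"
proof -
  let ?s = "q\<^sup>2 + p\<^sup>2"
  let ?P = "1 + cubic_harmonic q p / 500 + t\<^sup>2 * fock3_ratio ?s"
  have t2: "t\<^sup>2 = 3 / 4000000"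
    by (simp add: t power_divide)
  have "has_bochner_integral lborel
     (\<lambda>y. of_real (1 - \<epsilon>) * (exp (2 * \<i> * of_real p * of_real y) * ketbra \<psi> \<psi> (q - y) (q + y)) +
       of_real \<epsilon> * (2 / 3) * (exp (2 * \<i> * of_real p * of_real y) *
        (\<Sum>j. of_real ((1 / 3) ^ j) * ketbra (fock j) (fock j) (q - y) (q + y))))
     (of_real (1 - \<epsilon>) * of_real (exp (- q\<^sup>2 - p\<^sup>2) * ?P / (1 + t\<^sup>2))
       + of_real \<epsilon> * (2 / 3) * of_real (exp (- ((1 - 1 / 3) / (1 + 1 / 3) * ?s)) / (1 + 1 / 3)))"
    by (intro has_bochner_integral_add has_bochner_integral_mult_right
        wigner_integrand_superposition[OF t \<psi>] wigner_integrand_thermal) simp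
  moreover have "of_real (1 - \<epsilon>) * (exp (2 * \<i> * of_real p * of_real y) * ketbra \<psi> \<psi> (q - y) (q + y)) +
       of_real \<epsilon> * (2 / 3) * (exp (2 * \<i> * of_real p * of_real y) *
        (\<Sum>j. of_real ((1 / 3) ^ j) * ketbra (fock j) (fock j) (q - y) (q + y))) =
      exp (2 * \<i> * of_real p * of_real y) * \<rho> (q - y) (q + y)" for y
    unfolding \<rho> \<tau> by (simp add: algebra_simps power_divide)
  ultimately have "wigner \<rho> q p = 1 / pi * Re (of_real (1 - \<epsilon>) * of_real (exp (- q\<^sup>2 - p\<^sup>2) * ?P / (1 + t\<^sup>2))
       + of_real \<epsilon> * (2 / 3) * of_real (exp (- ((1 - 1 / 3) / (1 + 1 / 3) * ?s)) / (1 + 1 / 3)))"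
    unfolding wigner_def by (simp add: has_bochner_integral_integral_eq)
  also have "\<dots> = 1 / pi * ((1 - \<epsilon>) * (exp (- q\<^sup>2 - p\<^sup>2) * ?P / (1 + t\<^sup>2)) + \<epsilon> / 2 * exp (- (?s / 2)))"
    by simp
  also have "exp (- (?s / 2)) = exp (- q\<^sup>2 - p\<^sup>2) * exp (?s / 2)"
    unfolding exp_add[symmetric] by (simp add: field_simps)
  finally show ?thesis
    unfolding wigner_vacuum_def vacuum_ratio_def t2 \<epsilon> by (simp add: algebra_simps)
qed

section \<open>Positivity\<close>

text \<open>|z^3|^2 = |z|^6 for z = q + i p; the square of the imaginary part is dropped.\<close>

lemma cubic_harmonic_sq_le: "(cubic_harmonic q p)\<^sup>2 \<le> (q\<^sup>2 + p\<^sup>2) ^ 3"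
proof -
  have "(cubic_harmonic q p)\<^sup>2 + (3 * q\<^sup>2 * p - p ^ 3)\<^sup>2 = (q\<^sup>2 + p\<^sup>2) ^ 3"
    by (simp add: cubic_harmonic_def algebra_simps eval_nat_numeral)
  then show ?thesis
    using zero_le_power2[of "3 * q\<^sup>2 * p - p ^ 3"] by linarith
qed

text \<open>Eleven terms of the series for e, raised to the power 44; the exponent belongs to the
  expansion point s = 88 of \<open>exp_half_ge\<close>.\<close>

lemma exp_44_ge: "1285 * 10 ^ 16 \<le> exp (44 :: real)"
proof -
  have "(\<Sum>n<11. 1 ^ n /\<^sub>R fact n) \<le> (\<Sum>n. (1 :: real) ^ n /\<^sub>R fact n)"
    by (rule sum_le_suminf) (use summable_exp_generic[of "1 :: real"] in auto)
  then have "(271828 / 100000 :: real) \<le> exp 1"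
    by (simp add: exp_def lessThan_nat_numeral lessThan_Suc fact_numeral eval_nat_numeral)
  then have "(271828 / 100000 :: real) ^ 44 \<le> exp 1 ^ 44"
    by (rule power_mono) simp
  also have "exp 1 ^ 44 = exp (44 :: real)"
    by (simp flip: exp_of_nat_mult)
  finally show ?thesis
    by (simp add: power_divide)
qed

text \<open>Split off exp 44 and square the tangent bound for exp ((s - 88) / 4); s >= 84 keeps that
  tangent nonnegative. With s = r^2 the bound is a polynomial, comparable with
  \<open>radial_bound\<close>.\<close>

lemma exp_half_ge:
  fixes s :: real
  assumes "84 \<le> s"
  shows "1285 * 10 ^ 16 * (1 + (s - 88) / 4)\<^sup>2 \<le> exp (s / 2)"
proof -
  have "(1 + (s - 88) / 4)\<^sup>2 \<le> (exp ((s - 88) / 4))\<^sup>2"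
    using assms by (intro power_mono exp_ge_add_one_self) (simp add: field_simps)
  then have "1285 * 10 ^ 16 * (1 + (s - 88) / 4)\<^sup>2 \<le> exp 44 * (exp ((s - 88) / 4))\<^sup>2"
    by (intro mult_mono exp_44_ge) auto
  also have "\<dots> = exp (s / 2)"
    unfolding power2_eq_square exp_add[symmetric] by (simp add: field_simps)
  finally show ?thesis .
qed

text \<open>
  At distance \<open>r\<close> from the origin the superposition alone can be as small as \<open>radial_bound r\<close>. This is
  negative around \<open>r = 10\<close>, where the thermal part has already grown large.
\<close>

definition radial_bound :: "real \<Rightarrow> real" where
  "radial_bound r = (1 - r ^ 3 / 1000)\<^sup>2 + 3 / 4000000 * (- 1 + 6 * r\<^sup>2 - 6 * r ^ 4)"

text \<open>The worst case is C = - r^3. Times t^2, the leading term of \<open>fock3_ratio\<close>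
  is exactly (r^3 / 1000)^2, which completes the square.\<close>

lemma radial_bound_le:
  fixes q p :: real
  defines "s \<equiv> q\<^sup>2 + p\<^sup>2"
  shows "radial_bound (sqrt s) \<le> 1 + cubic_harmonic q p / 500 + 3 / 4000000 * fock3_ratio s"
proof -
  define r where "r = sqrt s"
  have s: "0 \<le> s" "s = r\<^sup>2" and r: "0 \<le> r"
    by (simp_all add: s_def r_def)
  have "(cubic_harmonic q p)\<^sup>2 \<le> (r ^ 3)\<^sup>2"
    using cubic_harmonic_sq_le[of q p] unfolding s_def[symmetric] s(2) by (simp flip: power_mult)
  then have "\<bar>cubic_harmonic q p\<bar> \<le> r ^ 3"
    using r by (auto intro: power2_le_imp_le)
  then have "- (r ^ 3) \<le> cubic_harmonic q p"
    by linarith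
  moreover have "1 + C / 500 + 3 / 4000000 * fock3_ratio (r\<^sup>2) = radial_bound r + (C + r ^ 3) / 500" for C
    by (simp add: radial_bound_def fock3_ratio_def field_simps eval_nat_numeral)
  ultimately show ?thesis
    unfolding r_def[symmetric] unfolding s(2) by simp
qed

lemma radial_bound_thermal:
  assumes "0 \<le> r"
  shows "8 / 1000 < radial_bound r + 1 / 10 ^ 21 * exp (r\<^sup>2 / 2)"
proof (cases "r \<le> 92 / 10")
  case True
  \<comment> \<open>Up to 9.2 the square is at least 0.0489 and the quartic loss at most about
    0.0323, so the superposition alone suffices.\<close>
  have "r ^ 3 \<le> (92 / 10) ^ 3" and "r ^ 4 \<le> (92 / 10) ^ 4"
    using True assms by (auto intro: power_mono)
  then have r3: "r ^ 3 \<le> 778688 / 1000" and r4: "r ^ 4 \<le> 71639296 / 10000"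
    by (simp_all add: power_divide)
  have "(221312 / 1000000)\<^sup>2 \<le> (1 - r ^ 3 / 1000)\<^sup>2"
    using r3 by (intro power_mono) simp_all
  then have "48979 / 1000000 \<le> (1 - r ^ 3 / 1000)\<^sup>2"
    by (simp add: power_divide)
  then have "8 / 1000 < radial_bound r"
    unfolding radial_bound_def ring_distribs using r4 zero_le_power2[of r] by linarith
  then show ?thesis
    by (simp add: add_pos_pos less_le_trans)
next
  case False
  define x where "x = r - 92 / 10"
  have x: "0 < x" and r: "r = 92 / 10 + x"
    using False by (auto simp: x_def)
  have "84 \<le> r\<^sup>2"
    using False power_mono[of "92 / 10" r 2] by (simp add: power_divide)
  from exp_half_ge[OF this]
  have e: "1285 / 100000 * (1 + (r\<^sup>2 - 88) / 4)\<^sup>2 \<le> 1 / 10 ^ 21 * exp (r\<^sup>2 / 2)"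
    by simp
  \<comment> \<open>Expanded at 9.2, the difference has positive coefficients except for the linear
    one. This quadratic rounds its first three coefficients down and has no real zero.\<close>
  have "0 < 945 / 100000 - 10741 / 100000 * x + 322 / 1000 * x\<^sup>2"
  proof -
    have "945 / 100000 - 10741 / 100000 * x + 322 / 1000 * x\<^sup>2 =
        322 / 1000 * (x - 10741 / 64400)\<^sup>2 + (945 / 100000 - 10741\<^sup>2 / (4 * 322 * 10 ^ 7))"
      by (simp add: power2_eq_square algebra_simps)
    then show ?thesis
      by (simp add: add_nonneg_pos)
  qed
  moreover have "0 \<le> x\<^sup>2" "0 \<le> x ^ 3" "0 \<le> x ^ 4" "0 \<le> x ^ 5" "0 \<le> x ^ 6"
    using x by simp_all
  moreover have "radial_bound r + 1285 / 100000 * (1 + (r\<^sup>2 - 88) / 4)\<^sup>2 - 8 / 1000 =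
     (590650509 / 62500000000) + (-167827297 / 1562500000) * x + (80728041 / 250000000) * x ^ 2 + (1074079 / 25000000) * x ^ 3 + (82729 / 40000000) * x ^ 4 + (69 / 1250000) * x ^ 5 + (1 / 1000000) * x ^ 6"
    unfolding radial_bound_def r by (simp add: field_simps eval_nat_numeral)
  ultimately have "8 / 1000 < radial_bound r + 1285 / 100000 * (1 + (r\<^sup>2 - 88) / 4)\<^sup>2"
    using x by linarith
  with e show ?thesis by linarith
qed

text \<open>The prefactor \<open>c\<close> costs at most one percent of 8 / 1000; as c <= 1, the
  thermal term may be scaled by it as well.\<close>

lemma vacuum_ratio_gt: "79 / 10000 < vacuum_ratio q p"
proof -
  define X where "X = 1 + cubic_harmonic q p / 500 + 3 / 4000000 * fock3_ratio (q\<^sup>2 + p\<^sup>2)"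
  define E where "E = 1 / 10 ^ 21 * exp ((q\<^sup>2 + p\<^sup>2) / 2)"
  define c where "c = (1 - 2 / 10 ^ 21) / (1 + 3 / 4000000 :: real)"
  have c: "99 / 100 \<le> c" "c \<le> 1"
    by (simp_all add: c_def)
  have "8 / 1000 < X + E"
    using radial_bound_le[of q p] radial_bound_thermal[of "sqrt (q\<^sup>2 + p\<^sup>2)"]
    unfolding X_def E_def by simp
  then have "99 / 100 * (8 / 1000) < c * (X + E)"
    using c by (intro mult_le_less_imp_less) auto
  also have "\<dots> \<le> c * X + E"
    using c by (simp add: algebra_simps E_def)
  finally show ?thesis
    unfolding vacuum_ratio_def X_def[symmetric] E_def[symmetric] c_def[symmetric] by simp
qed

section \<open>Expectations with respect to the Wigner function of the vacuum\<close>

lemma has_bochner_integral_lborel_prod: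
  fixes f g :: "real \<Rightarrow> real"
  assumes f: "has_bochner_integral lborel f a" and g: "has_bochner_integral lborel g b"
  shows "has_bochner_integral lborel (\<lambda>(q, p). f q * g p) (a * b)"
proof -
  have [simp]: "integrable lborel f" "integrable lborel g"
    using f g by (auto simp: has_bochner_integral_iff)
  have [measurable]: "f \<in> borel_measurable borel" "g \<in> borel_measurable borel"
    using borel_measurable_integrable[of lborel f] borel_measurable_integrable[of lborel g] by auto
  have int: "integrable (lborel \<Otimes>\<^sub>M lborel) (\<lambda>(q, p). f q * g p)"
    by (rule lborel_pair.Fubini_integrable) (auto simp: abs_mult)
  moreover have "integral\<^sup>L (lborel \<Otimes>\<^sub>M lborel) (\<lambda>(q, p). f q * g p) = a * b"
    using lborel_pair.integral_fst[OF int] f g by (simp add: has_bochner_integral_iff)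
  ultimately show ?thesis
    by (simp add: has_bochner_integral_iff lborel_prod)
qed

text \<open>A relation that bundles integrability with the value, so that the linearity rules
  establish both at once.\<close>

definition has_vacuum_expectation :: "(real \<Rightarrow> real \<Rightarrow> real) \<Rightarrow> real \<Rightarrow> bool" where
  "has_vacuum_expectation f x \<longleftrightarrow>
     has_bochner_integral lborel (\<lambda>(q, p). wigner_vacuum q p * f q p) x"

lemma has_vacuum_expectation_eq:
  assumes "has_vacuum_expectation f x" "\<And>q p. f q p = g q p" "x = y"
  shows "has_vacuum_expectation g y"
  using assms by (simp add: has_vacuum_expectation_def)

lemma has_vacuum_expectation_add:
  "has_vacuum_expectation f x \<Longrightarrow> has_vacuum_expectation g y \<Longrightarrow>
     has_vacuum_expectation (\<lambda>q p. f q p + g q p) (x + y)"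
  unfolding has_vacuum_expectation_def
  by (drule (1) has_bochner_integral_add) (simp add: case_prod_unfold algebra_simps)

lemma has_vacuum_expectation_diff:
  "has_vacuum_expectation f x \<Longrightarrow> has_vacuum_expectation g y \<Longrightarrow>
     has_vacuum_expectation (\<lambda>q p. f q p - g q p) (x - y)"
  unfolding has_vacuum_expectation_def
  by (drule (1) has_bochner_integral_diff) (simp add: case_prod_unfold algebra_simps)

lemma has_vacuum_expectation_cmult:
  assumes "has_vacuum_expectation f x"
  shows "has_vacuum_expectation (\<lambda>q p. c * f q p) (c * x)"
  using has_bochner_integral_mult_right[OF assms[unfolded has_vacuum_expectation_def], of c]
  by (simp add: has_vacuum_expectation_def case_prod_unfold algebra_simps)

lemma has_vacuum_expectation_sum:
  "(\<And>i. i \<in> I \<Longrightarrow> has_vacuum_expectation (f i) (x i)) \<Longrightarrow>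
     has_vacuum_expectation (\<lambda>q p. \<Sum>i\<in>I. f i q p) (\<Sum>i\<in>I. x i)"
  unfolding has_vacuum_expectation_def
  by (drule has_bochner_integral_sum) (simp add: case_prod_unfold sum_distrib_left)

lemmas has_vacuum_expectation_linear =
  has_vacuum_expectation_add has_vacuum_expectation_diff has_vacuum_expectation_cmult

section \<open>Moments under the vacuum Wigner function\<close>

lemma vacuum_expectation_monomial:
  "has_vacuum_expectation (\<lambda>q p. q ^ m * p ^ n) (gauss_moment m * gauss_moment n)"
proof -
  have "has_bochner_integral lborel
      (\<lambda>(q, p). 1 / pi * ((exp (- q\<^sup>2) * q ^ m) * (exp (- p\<^sup>2) * p ^ n)))
      (1 / pi * (sqrt pi * gauss_moment m * (sqrt pi * gauss_moment n)))"
    using has_bochner_integral_mult_right[OF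
        has_bochner_integral_lborel_prod[OF gaussian_moment[of m] gaussian_moment[of n]], of "1 / pi"]
    by (simp add: case_prod_unfold)
  moreover have "1 / pi * ((exp (- q\<^sup>2) * q ^ m) * (exp (- p\<^sup>2) * p ^ n)) =
      wigner_vacuum q p * (q ^ m * p ^ n)" for q p
  proof -
    have "exp (- q\<^sup>2 - p\<^sup>2) = exp (- q\<^sup>2) * exp (- p\<^sup>2)"
      by (simp flip: exp_add)
    then show ?thesis by (simp add: wigner_vacuum_def)
  qed
  moreover have "1 / pi * (sqrt pi * gauss_moment m * (sqrt pi * gauss_moment n)) =
      gauss_moment m * gauss_moment n"
  proof -
    have "sqrt pi * gauss_moment m * (sqrt pi * gauss_moment n) =
        (sqrt pi * sqrt pi) * (gauss_moment m * gauss_moment n)"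
      by (simp only: mult_ac)
    also have "sqrt pi * sqrt pi = pi"
      by simp
    finally have eq: "sqrt pi * gauss_moment m * (sqrt pi * gauss_moment n) =
        pi * (gauss_moment m * gauss_moment n)" .
    show ?thesis unfolding eq by simp
  qed
  ultimately show ?thesis
    by (simp add: has_vacuum_expectation_def)
qed

lemma gauss_moment_even:
  "gauss_moment 0 = 1" "gauss_moment 2 = 1 / 2" "gauss_moment 4 = 3 / 4" "gauss_moment 6 = 15 / 8"
  "gauss_moment 8 = 105 / 16" "gauss_moment 10 = 945 / 32" "gauss_moment 12 = 10395 / 64"
  by (simp_all add: gauss_moment_def fact_numeral)

lemma gauss_moment_odd: "gauss_moment (Suc 0) = 0" "gauss_moment 3 = 0" "gauss_moment 5 = 0"
  by (simp_all add: gauss_moment_def)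

lemma vacuum_expectation_radial:
  "has_vacuum_expectation (\<lambda>q p. (q\<^sup>2 + p\<^sup>2) ^ k)
     (\<Sum>i\<le>k. of_nat (k choose i) * (gauss_moment (2 * i) * gauss_moment (2 * (k - i))))"
proof -
  have "has_vacuum_expectation
      (\<lambda>q p. \<Sum>i\<le>k. of_nat (k choose i) * (q ^ (2 * i) * p ^ (2 * (k - i))))
     (\<Sum>i\<le>k. of_nat (k choose i) * (gauss_moment (2 * i) * gauss_moment (2 * (k - i))))"
    by (intro has_vacuum_expectation_sum has_vacuum_expectation_cmult vacuum_expectation_monomial)
  then show ?thesis
    by (simp add: binomial_ring power_mult mult.assoc)
qed

text \<open>Under the vacuum \<open>q\<^sup>2 + p\<^sup>2\<close> is exponentially distributed with
  mean 1, hence the factorials.\<close>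

lemma vacuum_expectation_radial_values:
  "has_vacuum_expectation (\<lambda>q p. 1) 1"
  "has_vacuum_expectation (\<lambda>q p. q\<^sup>2 + p\<^sup>2) 1"
  "has_vacuum_expectation (\<lambda>q p. (q\<^sup>2 + p\<^sup>2)\<^sup>2) 2"
  "has_vacuum_expectation (\<lambda>q p. (q\<^sup>2 + p\<^sup>2) ^ 3) 6"
  "has_vacuum_expectation (\<lambda>q p. (q\<^sup>2 + p\<^sup>2) ^ 4) 24"
  "has_vacuum_expectation (\<lambda>q p. (q\<^sup>2 + p\<^sup>2) ^ 5) 120"
  "has_vacuum_expectation (\<lambda>q p. (q\<^sup>2 + p\<^sup>2) ^ 6) 720"
proof -
  note [simp] = gauss_moment_even atMost_nat_numeral atMost_Suc binomial_code
    fold_atLeastAtMost_nat.simps fact_numeral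
  show "has_vacuum_expectation (\<lambda>q p. 1) 1"
    using vacuum_expectation_radial[of 0] by simp
  show "has_vacuum_expectation (\<lambda>q p. q\<^sup>2 + p\<^sup>2) 1"
    using vacuum_expectation_radial[of 1] by simp
  show "has_vacuum_expectation (\<lambda>q p. (q\<^sup>2 + p\<^sup>2)\<^sup>2) 2"
    using vacuum_expectation_radial[of 2] by simp
  show "has_vacuum_expectation (\<lambda>q p. (q\<^sup>2 + p\<^sup>2) ^ 3) 6"
    using vacuum_expectation_radial[of 3] by simp
  show "has_vacuum_expectation (\<lambda>q p. (q\<^sup>2 + p\<^sup>2) ^ 4) 24"
    using vacuum_expectation_radial[of 4] by simp
  show "has_vacuum_expectation (\<lambda>q p. (q\<^sup>2 + p\<^sup>2) ^ 5) 120"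
    using vacuum_expectation_radial[of 5] by simp
  show "has_vacuum_expectation (\<lambda>q p. (q\<^sup>2 + p\<^sup>2) ^ 6) 720"
    using vacuum_expectation_radial[of 6] by simp
qed

text \<open>The first two vanish because every monomial is odd in \<open>q\<close>; the last is half
  of E s^3 = 6, by the angular mean of a squared cosine.\<close>

lemma vacuum_expectation_cubic:
  "has_vacuum_expectation cubic_harmonic 0"
  "has_vacuum_expectation (\<lambda>q p. cubic_harmonic q p * (q\<^sup>2 + p\<^sup>2)) 0"
  "has_vacuum_expectation (\<lambda>q p. (cubic_harmonic q p)\<^sup>2) 3"
proof -
  let ?m = "\<lambda>m n q p. q ^ m * p ^ n :: real"
  note intros = has_vacuum_expectation_linear vacuum_expectation_monomial
  have "has_vacuum_expectation (\<lambda>q p. ?m 3 0 q p - 3 * ?m 1 2 q p)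
      (gauss_moment 3 * gauss_moment 0 - 3 * (gauss_moment 1 * gauss_moment 2))"
    by (intro intros)
  then show "has_vacuum_expectation cubic_harmonic 0"
    by (rule has_vacuum_expectation_eq) (simp_all add: cubic_harmonic_def gauss_moment_odd)
  have "has_vacuum_expectation (\<lambda>q p. ?m 5 0 q p - 2 * ?m 3 2 q p - 3 * ?m 1 4 q p)
      (gauss_moment 5 * gauss_moment 0 - 2 * (gauss_moment 3 * gauss_moment 2)
         - 3 * (gauss_moment 1 * gauss_moment 4))"
    by (intro intros)
  then show "has_vacuum_expectation (\<lambda>q p. cubic_harmonic q p * (q\<^sup>2 + p\<^sup>2)) 0"
  proof (rule has_vacuum_expectation_eq)
    show "?m 5 0 q p - 2 * ?m 3 2 q p - 3 * ?m 1 4 q p = cubic_harmonic q p * (q\<^sup>2 + p\<^sup>2)" for q p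
      by (simp add: cubic_harmonic_def algebra_simps eval_nat_numeral)
  qed (simp add: gauss_moment_odd)
  have "has_vacuum_expectation (\<lambda>q p. ?m 6 0 q p - 6 * ?m 4 2 q p + 9 * ?m 2 4 q p)
      (gauss_moment 6 * gauss_moment 0 - 6 * (gauss_moment 4 * gauss_moment 2)
         + 9 * (gauss_moment 2 * gauss_moment 4))"
    by (intro intros)
  then show "has_vacuum_expectation (\<lambda>q p. (cubic_harmonic q p)\<^sup>2) 3"
  proof (rule has_vacuum_expectation_eq)
    show "?m 6 0 q p - 6 * ?m 4 2 q p + 9 * ?m 2 4 q p = (cubic_harmonic q p)\<^sup>2" for q p
      by (simp add: cubic_harmonic_def algebra_simps eval_nat_numeral)
  qed (simp add: gauss_moment_even)
qed

text \<open>The normalisation of |3><3|, its mean 2 * 3 + 1 of q^2 + p^2, and a second moment for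
  the error term.\<close>

lemma vacuum_expectation_fock3_ratio:
  "has_vacuum_expectation (\<lambda>q p. fock3_ratio (q\<^sup>2 + p\<^sup>2)) 1"
  "has_vacuum_expectation (\<lambda>q p. fock3_ratio (q\<^sup>2 + p\<^sup>2) * (q\<^sup>2 + p\<^sup>2)) 7"
  "has_vacuum_expectation (\<lambda>q p. (fock3_ratio (q\<^sup>2 + p\<^sup>2))\<^sup>2) 245"
proof -
  let ?s = "\<lambda>q p. q\<^sup>2 + p\<^sup>2 :: real"
  note intros = has_vacuum_expectation_linear vacuum_expectation_radial_values
  have "has_vacuum_expectation
     (\<lambda>q p. - 1 * 1 + 6 * ?s q p - 6 * (?s q p)\<^sup>2 + 4 / 3 * (?s q p) ^ 3)
     (- 1 * 1 + 6 * 1 - 6 * 2 + 4 / 3 * 6)"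
    by (intro intros)
  then show "has_vacuum_expectation (\<lambda>q p. fock3_ratio (?s q p)) 1"
    by (simp add: fock3_ratio_def)
  have "has_vacuum_expectation
     (\<lambda>q p. - 1 * ?s q p + 6 * (?s q p)\<^sup>2 - 6 * (?s q p) ^ 3 + 4 / 3 * (?s q p) ^ 4)
     (- 1 * 1 + 6 * 2 - 6 * 6 + 4 / 3 * 24)"
    by (intro intros)
  moreover have "- 1 * s + 6 * s\<^sup>2 - 6 * s ^ 3 + 4 / 3 * s ^ 4 = fock3_ratio s * s" for s
    by (simp add: fock3_ratio_def algebra_simps eval_nat_numeral)
  ultimately show "has_vacuum_expectation (\<lambda>q p. fock3_ratio (?s q p) * ?s q p) 7"
    by (rule has_vacuum_expectation_eq) simp
  have "has_vacuum_expectation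
     (\<lambda>q p. 1 - 12 * ?s q p + 48 * (?s q p)\<^sup>2 - 224 / 3 * (?s q p) ^ 3 + 52 * (?s q p) ^ 4
        - 16 * (?s q p) ^ 5 + 16 / 9 * (?s q p) ^ 6)
     (1 - 12 * 1 + 48 * 2 - 224 / 3 * 6 + 52 * 24 - 16 * 120 + 16 / 9 * 720)"
    by (intro intros)
  moreover have "1 - 12 * s + 48 * s\<^sup>2 - 224 / 3 * s ^ 3 + 52 * s ^ 4 - 16 * s ^ 5 + 16 / 9 * s ^ 6 =
      (fock3_ratio s)\<^sup>2" for s
    by (simp add: fock3_ratio_def algebra_simps eval_nat_numeral)
  ultimately show "has_vacuum_expectation (\<lambda>q p. (fock3_ratio (?s q p))\<^sup>2) 245"
    by (rule has_vacuum_expectation_eq) simp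
qed

text \<open>\<open>wigner_vacuum\<close> times exp (s / 2) is twice the standard normal density of
  the plane. The square of this exponential would cancel the Gaussian decay entirely.\<close>

lemma vacuum_expectation_exp:
  "has_vacuum_expectation (\<lambda>q p. exp ((q\<^sup>2 + p\<^sup>2) / 2)) 2"
  "has_vacuum_expectation (\<lambda>q p. exp ((q\<^sup>2 + p\<^sup>2) / 2) * (q\<^sup>2 + p\<^sup>2)) 4"
proof -
  have W: "wigner_vacuum q p * exp ((q\<^sup>2 + p\<^sup>2) / 2) = 2 * (std_normal_density q * std_normal_density p)" for q p
  proof -
    have "exp (- q\<^sup>2 - p\<^sup>2) * exp ((q\<^sup>2 + p\<^sup>2) / 2) = exp (- q\<^sup>2 / 2) * exp (- p\<^sup>2 / 2)"
      unfolding exp_add[symmetric] by (simp add: field_simps)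
    then show ?thesis
      by (simp add: wigner_vacuum_def std_normal_density_def)
  qed
  note m0 = normal_moment_even[of 1 0 0, simplified]
  note m2 = normal_moment_even[of 1 0 1, simplified]
  have "has_bochner_integral lborel (\<lambda>(q, p). 2 * (std_normal_density q * std_normal_density p)) 2"
    using has_bochner_integral_mult_right[OF has_bochner_integral_lborel_prod[OF m0 m0], of 2]
    by (simp add: case_prod_unfold)
  then show "has_vacuum_expectation (\<lambda>q p. exp ((q\<^sup>2 + p\<^sup>2) / 2)) 2"
    by (simp add: has_vacuum_expectation_def W)
  have "has_bochner_integral lborel
     (\<lambda>z. 2 * ((case z of (q, p) \<Rightarrow> (std_normal_density q * q\<^sup>2) * std_normal_density p)
        + (case z of (q, p) \<Rightarrow> std_normal_density q * (std_normal_density p * p\<^sup>2))))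
     (2 * (1 * 1 + 1 * 1))"
    by (intro has_bochner_integral_mult_right has_bochner_integral_add
        has_bochner_integral_lborel_prod m0 m2)
  then show "has_vacuum_expectation (\<lambda>q p. exp ((q\<^sup>2 + p\<^sup>2) / 2) * (q\<^sup>2 + p\<^sup>2)) 4"
    unfolding has_vacuum_expectation_def mult.assoc[symmetric] W
    by (simp add: case_prod_unfold algebra_simps)
qed

section \<open>A lower bound for relative entropy\<close>

text \<open>With x = 1 + u the left side is u + u^2 / 2. The difference of ln x and (x - 1 / x) / 2
  is decreasing and vanishes at 1.\<close>

lemma ln_le_one_bound:
  fixes x :: real
  assumes "0 < x" "x \<le> 1"
  shows "(x\<^sup>2 - 1) / 2 \<le> x * ln x"
proof -
  let ?h = "\<lambda>x::real. ln x - (x - 1 / x) / 2"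
  have "?h 1 \<le> ?h x"
  proof (rule DERIV_nonpos_imp_nonincreasing[OF assms(2)])
    fix y :: real assume "x \<le> y" "y \<le> 1"
    then have y: "0 < y" using assms by simp
    have "(?h has_real_derivative - ((y - 1)\<^sup>2 / (2 * y\<^sup>2))) (at y)"
      using y by (auto intro!: derivative_eq_intros simp: field_simps power2_eq_square)
    then show "\<exists>d. (?h has_real_derivative d) (at y) \<and> d \<le> 0"
      by (intro exI[of _ "- ((y - 1)\<^sup>2 / (2 * y\<^sup>2))"]) simp
  qed
  then have "x * ((x - 1 / x) / 2) \<le> x * ln x"
    using assms by (intro mult_left_mono) auto
  moreover have "x * ((x - 1 / x) / 2) = (x\<^sup>2 - 1) / 2"
    using assms by (simp add: field_simps power2_eq_square)
  ultimately show ?thesis by (simp only:)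
qed

text \<open>With x = 1 + u this yields u + u^2 / (2 + u) as a lower bound of x ln x, which keeps the
  leading coefficient 1/2.\<close>

lemma ln_ge_one_bound:
  fixes x :: real
  assumes "1 \<le> x"
  shows "2 * (x - 1) / (x + 1) \<le> ln x"
proof -
  let ?h = "\<lambda>x::real. ln x - 2 * (x - 1) / (x + 1)"
  have "?h 1 \<le> ?h x"
  proof (rule DERIV_nonneg_imp_nondecreasing[OF assms])
    fix y :: real assume "1 \<le> y" "y \<le> x"
    then have y: "0 < y" by simp
    have "(?h has_real_derivative 1 / y - 4 / (y + 1)\<^sup>2) (at y)"
      using y by (auto intro!: derivative_eq_intros simp: power2_eq_square)
    moreover have "1 / y - 4 / (y + 1)\<^sup>2 = (y - 1)\<^sup>2 / (y * (y + 1)\<^sup>2)"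
      using y by (simp add: divide_simps) (simp add: algebra_simps power2_eq_square)
    ultimately show "\<exists>d. (?h has_real_derivative d) (at y) \<and> 0 \<le> d"
      using y by (intro exI[of _ "1 / y - 4 / (y + 1)\<^sup>2"]) simp
  qed
  then show ?thesis by simp
qed

text \<open>For u <= 0 even the coefficient 1/2 of u^2 holds. For u > 0 lowering it to 9/20 and
  subtracting the quartic term absorbs the cubic error.\<close>

lemma entropy_quartic_bound:
  fixes u :: real
  assumes "- 1 / 2 \<le> u"
  shows "u + 9 / 20 * u\<^sup>2 - 2 * u ^ 4 \<le> (1 + u) * ln (1 + u)"
proof (cases "u \<le> 0")
  case True
  have "((1 + u)\<^sup>2 - 1) / 2 \<le> (1 + u) * ln (1 + u)"
    using assms True by (intro ln_le_one_bound) auto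
  moreover have "((1 + u)\<^sup>2 - 1) / 2 = u + u\<^sup>2 / 2"
    by (simp add: power2_eq_square field_simps)
  moreover have "0 \<le> u ^ 4" by simp
  ultimately show ?thesis
    using zero_le_power2[of u] by linarith
next
  case False
  then have u: "0 < u" by simp
  have "0 \<le> (2 * u - 9 / 80)\<^sup>2 + (1 / 10 - (9 / 80)\<^sup>2)"
    by (intro add_nonneg_nonneg) (simp_all add: power_divide)
  then have q: "0 \<le> 1 / 10 - 9 / 20 * u + 4 * u\<^sup>2"
    by (simp add: power2_eq_square algebra_simps)
  have "(2 + u) * (9 / 20 * u\<^sup>2 - 2 * u ^ 4) = u\<^sup>2 - u\<^sup>2 * (1 / 10 - 9 / 20 * u + 4 * u\<^sup>2) - 2 * u ^ 5"
    by (simp add: algebra_simps eval_nat_numeral)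
  also have "\<dots> \<le> u\<^sup>2"
    using mult_nonneg_nonneg[OF zero_le_power2[of u] q] zero_le_power[of u 5] u by linarith
  finally have "9 / 20 * u\<^sup>2 - 2 * u ^ 4 \<le> u\<^sup>2 / (2 + u)"
    using u by (simp add: pos_le_divide_eq mult.commute)
  then have "u + 9 / 20 * u\<^sup>2 - 2 * u ^ 4 \<le> u + u\<^sup>2 / (2 + u)"
    by simp
  also have "\<dots> = (1 + u) * (2 * (1 + u - 1) / (1 + u + 1))"
    using u by (simp add: field_simps power2_eq_square)
  also have "\<dots> \<le> (1 + u) * ln (1 + u)"
    using u by (intro mult_left_mono ln_ge_one_bound) auto
  finally show ?thesis .
qed

text \<open>Convexity: the left side is the tangent of x ln x at \<open>y\<close>.\<close>

lemma entropy_tangent: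
  fixes x y :: real
  assumes "0 < x" "0 < y"
  shows "x * ln y + x - y \<le> x * ln x"
proof -
  have "ln (y / x) \<le> y / x - 1"
    using assms by (intro ln_le_minus_one) simp
  then have "x * (ln y - ln x) \<le> x * (y / x - 1)"
    using assms by (intro mult_left_mono) (auto simp: ln_div)
  then show ?thesis
    using assms by (simp add: algebra_simps)
qed

text \<open>
  \<open>u\<close> is the dominant perturbation and \<open>v + w\<close> a correction, with \<open>w \<ge> 0\<close> too heavy-tailed to be
  squared. The bound is the tangent of \<open>x ln x\<close> at \<open>1 + u\<close>, or at \<open>1\<close> when \<open>1 + u\<close> is small.
\<close>

lemma entropy_perturbation_bound:
  fixes u v w :: real
  assumes pos: "0 < 1 + u + v + w" and w: "0 \<le> w"
  shows "u + v + w + (2 / 5 * u\<^sup>2 - 2 * u ^ 4 - 20 * v\<^sup>2 - w) \<le> (1 + u + v + w) * ln (1 + u + v + w)"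
proof (cases "- 1 / 2 \<le> u")
  case True
  \<comment> \<open>The logarithm will multiply \<open>v\<close> and \<open>w\<close>: its modulus
    bound 2 |u| suits the product with \<open>v\<close>, and the lower bound - 1 keeps
    \<open>w\<close> linear.\<close>
  have l2: "- (2 * \<bar>u\<bar>) \<le> ln (1 + u)" "ln (1 + u) \<le> 2 * \<bar>u\<bar>" "- 1 \<le> ln (1 + u)"
  proof -
    have "1 - 1 / (1 + u) \<le> ln (1 + u)"
      using True ln_le_minus_one[of "1 / (1 + u)"] by (simp add: ln_div)
    moreover have "- (2 * \<bar>u\<bar>) \<le> 1 - 1 / (1 + u)"
    proof (cases "u \<ge> 0")
      case True
      then show ?thesis by (simp add: field_simps)
    next
      case False
      then have "u * (1 + 2 * u) \<le> 0"
        using True by (intro mult_nonpos_nonneg) auto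
      then show ?thesis
        using True False by (simp add: field_simps)
    qed
    moreover have "- 1 \<le> 1 - 1 / (1 + u)"
      using True by (simp add: field_simps)
    moreover have "ln (1 + u) \<le> u"
      using True by (intro ln_add_one_self_le_self2) simp
    ultimately show "- (2 * \<bar>u\<bar>) \<le> ln (1 + u)" "ln (1 + u) \<le> 2 * \<bar>u\<bar>" "- 1 \<le> ln (1 + u)"
      by linarith+
  qed
  have "- w \<le> w * ln (1 + u)"
    using mult_left_mono[OF l2(3) w] by simp
  \<comment> \<open>Young's inequality; the share u^2 / 20 is the gap between 9/20 and 2/5.\<close>
  moreover have "- (1 / 20 * u\<^sup>2 + 20 * v\<^sup>2) \<le> v * ln (1 + u)"
  proof -
    have "\<bar>v * ln (1 + u)\<bar> \<le> \<bar>v\<bar> * (2 * \<bar>u\<bar>)"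
      unfolding abs_mult using l2 by (intro mult_left_mono) auto
    moreover have "0 \<le> (\<bar>u\<bar> / 20 - \<bar>v\<bar>)\<^sup>2 * 20"
      by simp
    then have "\<bar>v\<bar> * (2 * \<bar>u\<bar>) \<le> 1 / 20 * u\<^sup>2 + 20 * v\<^sup>2"
      by (simp add: power2_diff power_divide algebra_simps)
    ultimately show ?thesis by linarith
  qed
  moreover have "(1 + u + v + w) * ln (1 + u) + (1 + u + v + w) - (1 + u)
      \<le> (1 + u + v + w) * ln (1 + u + v + w)"
    using pos True by (intro entropy_tangent) auto
  moreover have "(1 + u + v + w) * ln (1 + u) = (1 + u) * ln (1 + u) + v * ln (1 + u) + w * ln (1 + u)"
    by (simp add: algebra_simps)
  ultimately show ?thesis
    using entropy_quartic_bound[OF True] by linarith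
next
  case False
  \<comment> \<open>Here u^2 is at least 1/4, so 2 u^4 outweighs 2/5 u^2 and the tangent at 1
    suffices.\<close>
  have "(1 / 2)\<^sup>2 \<le> (- u)\<^sup>2"
    using False by (intro power_mono) auto
  then have "u\<^sup>2 * (2 / 5) \<le> u\<^sup>2 * (2 * u\<^sup>2)"
    by (intro mult_left_mono) (auto simp: power_divide)
  then have "2 / 5 * u\<^sup>2 - 2 * u ^ 4 \<le> 0"
    by (simp add: algebra_simps flip: power_add)
  moreover have "u + v + w \<le> (1 + u + v + w) * ln (1 + u + v + w)"
    using entropy_tangent[OF pos, of 1] by simp
  ultimately show ?thesis
    using w zero_le_power2[of v] by linarith
qed

section \<open>The entropy of the mixture\<close>

text \<open>The first is the trace: c (1 + t^2) = 1 - \<epsilon>, and the thermal part adds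
  \<epsilon>. The second is the mean of q^2 + p^2, to which the thermal state contributes 2
  \<epsilon>.\<close>

lemma vacuum_expectation_vacuum_ratio:
  "has_vacuum_expectation vacuum_ratio 1"
  "has_vacuum_expectation (\<lambda>q p. vacuum_ratio q p * (q\<^sup>2 + p\<^sup>2))
     ((1 - 2 / 10 ^ 21) / (1 + 3 / 4000000) * (1 + 3 / 4000000 * 7) + 4 / 10 ^ 21)"
proof -
  let ?c = "(1 - 2 / 10 ^ 21) / (1 + 3 / 4000000) :: real"
  let ?s = "\<lambda>q p. q\<^sup>2 + p\<^sup>2 :: real"
  note intros = has_vacuum_expectation_linear vacuum_expectation_radial_values
    vacuum_expectation_cubic vacuum_expectation_fock3_ratio vacuum_expectation_exp
  have "has_vacuum_expectation (\<lambda>q p. ?c * (1 + 1 / 500 * cubic_harmonic q p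
       + 3 / 4000000 * fock3_ratio (?s q p)) + 1 / 10 ^ 21 * exp (?s q p / 2))
     (?c * (1 + 1 / 500 * 0 + 3 / 4000000 * 1) + 1 / 10 ^ 21 * 2)"
    by (intro intros)
  then show "has_vacuum_expectation vacuum_ratio 1"
    by (rule has_vacuum_expectation_eq) (simp_all add: vacuum_ratio_def)
  have "has_vacuum_expectation (\<lambda>q p. ?c * (?s q p + 1 / 500 * (cubic_harmonic q p * ?s q p)
       + 3 / 4000000 * (fock3_ratio (?s q p) * ?s q p)) + 1 / 10 ^ 21 * (exp (?s q p / 2) * ?s q p))
     (?c * (1 + 1 / 500 * 0 + 3 / 4000000 * 7) + 1 / 10 ^ 21 * 4)"
    by (intro intros)
  then show "has_vacuum_expectation (\<lambda>q p. vacuum_ratio q p * ?s q p)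
     (?c * (1 + 3 / 4000000 * 7) + 4 / 10 ^ 21)"
  proof (rule has_vacuum_expectation_eq)
    have "c * (s + 1 / 500 * (C * s) + 3 / 4000000 * (M * s)) + 1 / 10 ^ 21 * (E * s) =
       (c * (1 + C / 500 + 3 / 4000000 * M) + 1 / 10 ^ 21 * E) * s" for c s C M E :: real
      by (simp add: algebra_simps)
    then show "?c * (?s q p + 1 / 500 * (cubic_harmonic q p * ?s q p)
       + 3 / 4000000 * (fock3_ratio (?s q p) * ?s q p)) + 1 / 10 ^ 21 * (exp (?s q p / 2) * ?s q p) =
      vacuum_ratio q p * ?s q p" for q p
      unfolding vacuum_ratio_def .
  qed simp
qed

section \<open>Integrability and pointwise estimates of the entropy density\<close>

lemma wigner_vacuum_pos: "0 < wigner_vacuum q p"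
  by (simp add: wigner_vacuum_def)

text \<open>A crude bound that makes the logarithm of the ratio grow at most linearly in s; cubic
  polynomials are dominated through (1 + s / 3)^3 <= exp s.\<close>

lemma vacuum_ratio_le: "vacuum_ratio q p \<le> 10 * exp (q\<^sup>2 + p\<^sup>2)"
proof -
  define s where "s = q\<^sup>2 + p\<^sup>2"
  define C where "C = cubic_harmonic q p"
  have s: "0 \<le> s" by (simp add: s_def)
  have "(1 + s / 3) ^ 3 \<le> exp (s / 3) ^ 3"
    using s by (intro power_mono) auto
  also have "\<dots> = exp s"
    by (simp flip: exp_of_nat_mult)
  also have "(1 + s / 3) ^ 3 = 1 + s + s\<^sup>2 / 3 + s ^ 3 / 27"
    by (simp add: field_simps eval_nat_numeral)
  finally have "1 + s + s\<^sup>2 / 3 + s ^ 3 / 27 \<le> exp s" .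
  moreover have "C \<le> 1 + s ^ 3"
  proof (rule power2_le_imp_le)
    have "C\<^sup>2 \<le> s ^ 3"
      using cubic_harmonic_sq_le[of q p] by (simp only: C_def s_def)
    also have "\<dots> \<le> (1 + s ^ 3)\<^sup>2"
      using s zero_le_power[OF s, of 3] by (simp add: power2_sum)
    finally show "C\<^sup>2 \<le> (1 + s ^ 3)\<^sup>2" .
  qed (use s in simp)
  moreover have "0 \<le> s\<^sup>2" "0 \<le> s ^ 3"
    using s by simp_all
  ultimately have X: "1 + C / 500 + 3 / 4000000 * fock3_ratio s \<le> 9 * exp s"
    unfolding fock3_ratio_def ring_distribs using s by linarith
  have e: "1 / 10 ^ 21 * exp (s / 2) \<le> 1 * exp s"
    using s by (intro mult_mono) auto
  have "(1 - 2 / 10 ^ 21) / (1 + 3 / 4000000) * (1 + C / 500 + 3 / 4000000 * fock3_ratio s) \<le>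
      (1 - 2 / 10 ^ 21) / (1 + 3 / 4000000) * (9 * exp s)"
    using X by (rule mult_left_mono) simp
  also have "\<dots> \<le> 1 * (9 * exp s)"
    by (rule mult_right_mono) simp_all
  finally show ?thesis
    unfolding vacuum_ratio_def C_def[symmetric] s_def[symmetric] using e by linarith
qed

lemma neg_vacuum_ratio_entropy_le:
  fixes q p :: real
  defines "s \<equiv> q\<^sup>2 + p\<^sup>2" and "c \<equiv> (1 - 2 / 10 ^ 21) / (1 + 3 / 4000000)"
  shows "- (vacuum_ratio q p * ln (vacuum_ratio q p)) \<le>
     1 - vacuum_ratio q p - 2 / 5 * c\<^sup>2 / 250000 * (cubic_harmonic q p)\<^sup>2 + 2 / 250000\<^sup>2 * s ^ 6
     + 4 / 10 ^ 11 * (1 + (fock3_ratio s)\<^sup>2) + 1 / 10 ^ 21 * exp (s / 2)"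
proof -
  define C where "C = cubic_harmonic q p"
  define M where "M = fock3_ratio s"
  \<comment> \<open>\<open>u\<close> is the part of first order in t, \<open>v\<close> the
    second-order radial part with the normalisation defect, \<open>w\<close> the thermal
    part.\<close>
  define u where "u = c * C / 500"
  define v where "v = (c - 1) + c * (3 / 4000000) * M"
  define w where "w = 1 / 10 ^ 21 * exp (s / 2)"
  have c: "0 \<le> c" "c \<le> 1" "1 - c \<le> 1 / 10 ^ 6" "c * (3 / 4000000) \<le> 1 / 10 ^ 6"
    by (simp_all add: c_def)
  have F: "1 + u + v + w = vacuum_ratio q p"
    by (simp add: vacuum_ratio_def u_def v_def w_def C_def M_def s_def c_def field_simps)
  have "0 < 1 + u + v + w"
    unfolding F using vacuum_ratio_gt[of q p] by simp
  moreover have "0 \<le> w"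
    by (simp add: w_def)
  ultimately have "u + v + w + (2 / 5 * u\<^sup>2 - 2 * u ^ 4 - 20 * v\<^sup>2 - w) \<le>
      (1 + u + v + w) * ln (1 + u + v + w)"
    by (rule entropy_perturbation_bound)
  moreover have "u\<^sup>2 = c\<^sup>2 / 250000 * C\<^sup>2"
    by (simp add: u_def power_mult_distrib power_divide)
  moreover have "u ^ 4 \<le> 1 / 250000\<^sup>2 * s ^ 6"
  proof -
    have "u\<^sup>2 \<le> 1 / 250000 * s ^ 3"
      using mult_mono[of "c\<^sup>2" 1 "C\<^sup>2" "s ^ 3"] c cubic_harmonic_sq_le[of q p]
      by (simp add: u_def power_mult_distrib power_divide power_le_one C_def s_def)
    then have "(u\<^sup>2)\<^sup>2 \<le> (1 / 250000 * s ^ 3)\<^sup>2"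
      by (intro power_mono) auto
    then show ?thesis
      by (simp add: power_mult_distrib power_divide flip: power_mult)
  qed
  \<comment> \<open>Both coefficients in \<open>v\<close> are at most 10^-6 in modulus, and (a +
    b)^2 <= 2 a^2 + 2 b^2 gives 20 * 2 * 10^-12.\<close>
  moreover have "20 * v\<^sup>2 \<le> 4 / 10 ^ 11 * (1 + M\<^sup>2)"
  proof -
    have a: "(c - 1)\<^sup>2 \<le> (1 / 10 ^ 6)\<^sup>2" "(c * (3 / 4000000))\<^sup>2 \<le> (1 / 10 ^ 6)\<^sup>2"
      using c power_mono[of "1 - c" "1 / 10 ^ 6" 2] power_mono[of "c * (3 / 4000000)" "1 / 10 ^ 6" 2]
      by (simp_all add: power2_commute)
    have "v\<^sup>2 + ((c - 1) - c * (3 / 4000000) * M)\<^sup>2 = 2 * (c - 1)\<^sup>2 + 2 * ((c * (3 / 4000000))\<^sup>2 * M\<^sup>2)"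
      by (simp add: v_def power2_eq_square algebra_simps)
    then have "v\<^sup>2 \<le> 2 * (c - 1)\<^sup>2 + 2 * ((c * (3 / 4000000))\<^sup>2 * M\<^sup>2)"
      using zero_le_power2[of "(c - 1) - c * (3 / 4000000) * M"] by linarith
    also have "\<dots> \<le> 2 * (1 / 10 ^ 6)\<^sup>2 + 2 * ((1 / 10 ^ 6)\<^sup>2 * M\<^sup>2)"
      using a by (intro add_mono mult_left_mono mult_right_mono) auto
    finally show ?thesis by (simp add: power_divide)
  qed
  ultimately show ?thesis
    unfolding F[symmetric] C_def[symmetric] M_def[symmetric] w_def[symmetric] by linarith
qed

text \<open>Positivity gives ln F >= 1 - 127 and \<open>vacuum_ratio_le\<close> gives ln F <= 9 + s,
  so finite mean energy implies integrability.\<close>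

lemma abs_vacuum_ratio_entropy_le:
  "\<bar>vacuum_ratio q p * (ln (vacuum_ratio q p) - (q\<^sup>2 + p\<^sup>2) - ln pi)\<bar> \<le>
     2 * (vacuum_ratio q p * (q\<^sup>2 + p\<^sup>2)) + 200 * vacuum_ratio q p"
proof -
  define F where "F = vacuum_ratio q p"
  define s where "s = q\<^sup>2 + p\<^sup>2"
  have s: "0 \<le> s" by (simp add: s_def)
  have F: "79 / 10000 < F"
    unfolding F_def by (rule vacuum_ratio_gt)
  have "1 - 1 / F \<le> ln F"
    using F ln_le_minus_one[of "1 / F"] by (simp add: ln_div)
  moreover have "1 / F \<le> 127"
    using F by (simp add: field_simps)
  moreover have "ln F \<le> ln (10 * exp s)"
    using F vacuum_ratio_le[of q p] by (simp add: F_def s_def)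
  moreover have "ln (10 * exp s) = ln 10 + s"
    by (simp add: ln_mult)
  moreover have "ln 10 \<le> (10 :: real) - 1"
    by (rule ln_le_minus_one) simp
  moreover have "ln pi \<le> pi - 1" "0 \<le> ln pi" "pi < 4"
    using pi_gt3 by (auto intro: ln_le_minus_one pi_less_4)
  ultimately have "\<bar>ln F - s - ln pi\<bar> \<le> 2 * s + 200"
    using s by linarith
  then have "F * \<bar>ln F - s - ln pi\<bar> \<le> F * (2 * s + 200)"
    using F by (intro mult_left_mono) auto
  moreover have "F * (2 * s + 200) = 2 * (F * s) + 200 * F"
    by (simp add: algebra_simps)
  ultimately have "\<bar>F * (ln F - s - ln pi)\<bar> \<le> 2 * (F * s) + 200 * F"
    using F by (simp add: abs_mult)
  then show ?thesis
    by (simp only: F_def s_def)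
qed

lemma entropy_integrand_vacuum_ratio:
  "entropy_integrand (\<lambda>q p. wigner_vacuum q p * vacuum_ratio q p) =
     (\<lambda>(q, p). wigner_vacuum q p *
        (vacuum_ratio q p * (ln (vacuum_ratio q p) - (q\<^sup>2 + p\<^sup>2) - ln pi)))"
proof -
  have "ln (wigner_vacuum q p * vacuum_ratio q p) =
      ln (vacuum_ratio q p) - (q\<^sup>2 + p\<^sup>2) - ln pi" for q p
    using vacuum_ratio_gt[of q p] wigner_vacuum_pos[of q p]
    by (subst ln_mult_pos) (auto simp: wigner_vacuum_def ln_div)
  then show ?thesis
    by (simp add: entropy_integrand_def case_prod_unfold mult.assoc)
qed

lemma integrable_entropy_integrand:
  "integrable lborel (entropy_integrand (\<lambda>q p. wigner_vacuum q p * vacuum_ratio q p))"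
proof (rule Bochner_Integration.integrable_bound)
  have "has_vacuum_expectation
      (\<lambda>q p. 2 * (vacuum_ratio q p * (q\<^sup>2 + p\<^sup>2)) + 200 * vacuum_ratio q p)
      (2 * ((1 - 2 / 10 ^ 21) / (1 + 3 / 4000000) * (1 + 3 / 4000000 * 7) + 4 / 10 ^ 21) + 200 * 1)"
    by (intro has_vacuum_expectation_linear vacuum_expectation_vacuum_ratio)
  then show "integrable lborel (\<lambda>(q, p). wigner_vacuum q p *
      (2 * (vacuum_ratio q p * (q\<^sup>2 + p\<^sup>2)) + 200 * vacuum_ratio q p))"
    by (simp add: has_vacuum_expectation_def has_bochner_integral_iff)
  show "entropy_integrand (\<lambda>q p. wigner_vacuum q p * vacuum_ratio q p) \<in> borel_measurable lborel"
    unfolding entropy_integrand_def wigner_vacuum_def vacuum_ratio_def fock3_ratio_def cubic_harmonic_def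
      case_prod_unfold borel_prod[symmetric] measurable_lborel2
    by measurable
  show "AE z in lborel. norm (entropy_integrand (\<lambda>q p. wigner_vacuum q p * vacuum_ratio q p) z) \<le>
     norm (case z of (q, p) \<Rightarrow> wigner_vacuum q p *
       (2 * (vacuum_ratio q p * (q\<^sup>2 + p\<^sup>2)) + 200 * vacuum_ratio q p))"
  proof (rule AE_I2)
    fix z :: "real \<times> real"
    obtain q p where z: "z = (q, p)" by (cases z)
    show "norm (entropy_integrand (\<lambda>q p. wigner_vacuum q p * vacuum_ratio q p) z) \<le>
       norm (case z of (q, p) \<Rightarrow> wigner_vacuum q p *
         (2 * (vacuum_ratio q p * (q\<^sup>2 + p\<^sup>2)) + 200 * vacuum_ratio q p))"
      unfolding entropy_integrand_vacuum_ratio z prod.case real_norm_def abs_mult[of "wigner_vacuum q p"]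
      using order_trans[OF abs_vacuum_ratio_entropy_le abs_ge_self] by (intro mult_left_mono) auto
  qed
qed

lemma phase_space_entropy_lt:
  "phase_space_entropy (\<lambda>q p. wigner_vacuum q p * vacuum_ratio q p) - (1 + ln pi) < 0"
proof -
  let ?c = "(1 - 2 / 10 ^ 21) / (1 + 3 / 4000000) :: real"
  let ?s = "\<lambda>q p. q\<^sup>2 + p\<^sup>2 :: real"
  \<comment> \<open>Pointwise majorant: - ln of the vacuum contributes s + ln pi, and the summand 1
    - F of \<open>neg_vacuum_ratio_entropy_le\<close> accounts for the - 1 beside
    \<open>ln pi\<close> and for the + 1.\<close>
  let ?D = "\<lambda>q p. vacuum_ratio q p * ?s q p + (ln pi - 1) * vacuum_ratio q p + 1
    - 2 / 5 * ?c\<^sup>2 / 250000 * (cubic_harmonic q p)\<^sup>2 + 2 / 250000\<^sup>2 * (?s q p) ^ 6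
     + 4 / 10 ^ 11 * (1 + (fock3_ratio (?s q p))\<^sup>2) + 1 / 10 ^ 21 * exp (?s q p / 2)"
  let ?x = "(?c * (1 + 3 / 4000000 * 7) + 4 / 10 ^ 21) + (ln pi - 1) * 1 + 1
    - 2 / 5 * ?c\<^sup>2 / 250000 * 3 + 2 / 250000\<^sup>2 * 720 + 4 / 10 ^ 11 * (1 + 245) + 1 / 10 ^ 21 * 2"
  have D: "has_vacuum_expectation ?D ?x"
    by (intro has_vacuum_expectation_linear vacuum_expectation_vacuum_ratio
      vacuum_expectation_radial_values vacuum_expectation_cubic vacuum_expectation_fock3_ratio
      vacuum_expectation_exp)
  let ?I = "entropy_integrand (\<lambda>q p. wigner_vacuum q p * vacuum_ratio q p)"
  have "phase_space_entropy (\<lambda>q p. wigner_vacuum q p * vacuum_ratio q p) = (LINT z|lborel. - ?I z)"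
    by (simp add: phase_space_entropy_def)
  also have "\<dots> \<le> (LINT z|lborel. (case z of (q, p) \<Rightarrow> wigner_vacuum q p * ?D q p))"
  proof (rule integral_mono)
    show "integrable lborel (\<lambda>z. - ?I z)"
      using integrable_entropy_integrand by simp
    show "integrable lborel (\<lambda>(q, p). wigner_vacuum q p * ?D q p)"
      using D by (simp add: has_vacuum_expectation_def has_bochner_integral_iff)
    fix z :: "real \<times> real"
    obtain q p where z: "z = (q, p)" by (cases z)
    have "- (vacuum_ratio q p * (ln (vacuum_ratio q p) - ?s q p - ln pi)) =
        - (vacuum_ratio q p * ln (vacuum_ratio q p)) + vacuum_ratio q p * ?s q p + ln pi * vacuum_ratio q p"
      by (simp add: algebra_simps)
    also have "\<dots> \<le> ?D q p"
      unfolding left_diff_distrib[of "ln pi"] using neg_vacuum_ratio_entropy_le[of q p] by linarith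
    finally have "wigner_vacuum q p * - (vacuum_ratio q p * (ln (vacuum_ratio q p) - ?s q p - ln pi)) \<le>
        wigner_vacuum q p * ?D q p"
      by (rule mult_left_mono) (rule wigner_vacuum_pos[THEN less_imp_le])
    then show "- ?I z \<le> (case z of (q, p) \<Rightarrow> wigner_vacuum q p * ?D q p)"
      unfolding entropy_integrand_vacuum_ratio z prod.case mult_minus_right .
  qed
  also have "\<dots> = ?x"
    using D unfolding has_vacuum_expectation_def by (rule has_bochner_integral_integral_eq)
  finally have "phase_space_entropy (\<lambda>q p. wigner_vacuum q p * vacuum_ratio q p) \<le> ?x" .
  \<comment> \<open>Relative to 1 + ln pi the energy adds about 4.5 * 10^-6 and the errors about 3.3
    * 10^-8, while the quadratic term removes about 4.8 * 10^-6. The coefficient 2/5 exceeds the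
    break-even value 3/8.\<close>
  moreover have "?x < 1 + ln pi"
    by (simp add: power_divide)
  ultimately show ?thesis by linarith
qed

text \<open>The integrability clause gives the last inequality its content: for a non-integrable
  integrand the entropy would default to 0, which is below 1 + ln pi.\<close>

theorem mainTheorem7:
  fixes t \<epsilon> :: real and \<psi> :: wavefunction and \<tau> \<rho> :: kernel
  assumes "t = sqrt 3 / 2000"
    and "\<epsilon> = 2 / 10 ^ 21"
    and "\<psi> = (\<lambda>x. (fock 0 x + of_real t * fock 3 x) / of_real (sqrt (1 + t\<^sup>2)))"
    and "\<tau> = (\<lambda>x x'. 2 / 3 * (\<Sum>j. (1 / 3 ^ j) * ketbra (fock j) (fock j) x x'))"
    and "\<rho> = (\<lambda>x x'. of_real (1 - \<epsilon>) * ketbra \<psi> \<psi> x x' + of_real \<epsilon> * \<tau> x x')"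
  shows "(\<forall>q p. wigner \<rho> q p > 79 / 10000 * wigner_vacuum q p
              \<and> 79 / 10000 * wigner_vacuum q p > 0)
       \<and> integrable lborel (entropy_integrand (wigner \<rho>))
       \<and> phase_space_entropy (wigner \<rho>) - (1 + ln pi) < 0"
proof -
  have "wigner \<rho> = (\<lambda>q p. wigner_vacuum q p * vacuum_ratio q p)"
    using wigner_mixture[OF assms] by (intro ext)
  moreover have "79 / 10000 * wigner_vacuum q p < wigner_vacuum q p * vacuum_ratio q p" for q p
    using mult_strict_left_mono[OF vacuum_ratio_gt wigner_vacuum_pos, of q p q p]
    by (simp add: mult.commute)
  ultimately show ?thesis
    using integrable_entropy_integrand phase_space_entropy_lt wigner_vacuum_pos by simp
qed

end
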